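(* Let $r \geq 3$ and $s \geq 3$ be integers and let $F$ be a graph with chromatic number $\chi(F) = r+1$. Then, as $m \to \infty$, \[ \mathrm{mex}_{K_s}(m, F) = \mathrm{mex}_{K_s}(m, K_{r+1}) + o(m^{s/2}). \]
   Context: All graphs are finite and simple. For graphs $T$ and $F$, $\mathrm{mex}_T(m,F)$ is the maximum number of copies of $T$ in an $F$-free graph (a graph containing no subgraph isomorphic to $F$) with exactly $m$ edges, where no restriction is placed on the number of vertices. For $T = K_s$ this counts $s$-cliques. *)

theory Defs
  imports Complex_Main "HOL-Library.Landau_Symbols" "HOL-Library.Ramsey"
begin

(* A graph is a pair of a vertex set and a set of edges; edges are 2-element sets of vertices,
   so there are no loops and no multiple edges. From HOL-Library.Ramsey, nsets V 2 is the
   set of all 2-element subsets of V. *)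
type_synonym 'a sgraph = "'a set \<times> 'a set set"

abbreviation verts :: "'a sgraph \<Rightarrow> 'a set" where
  "verts G \<equiv> fst G"

abbreviation edges :: "'a sgraph \<Rightarrow> 'a set set" where
  "edges G \<equiv> snd G"

definition finite_simple_graph :: "'a sgraph \<Rightarrow> bool" where
  "finite_simple_graph G \<longleftrightarrow> finite (verts G) \<and> edges G \<subseteq> nsets (verts G) 2"

definition complete_graph :: "nat \<Rightarrow> nat sgraph" where
  "complete_graph n = ({..<n}, nsets {..<n} 2)"

definition subgraph :: "'a sgraph \<Rightarrow> 'a sgraph \<Rightarrow> bool" where
  "subgraph H G \<longleftrightarrow> finite_simple_graph H \<and> verts H \<subseteq> verts G \<and> edges H \<subseteq> edges G"

definition isomorphic :: "'a sgraph \<Rightarrow> 'b sgraph \<Rightarrow> bool" where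
  "isomorphic G H \<longleftrightarrow>
     (\<exists>f. bij_betw f (verts G) (verts H) \<and> (\<lambda>e. f ` e) ` edges G = edges H)"

definition copies :: "'a sgraph \<Rightarrow> 'b sgraph \<Rightarrow> 'b sgraph set" where
  "copies T G = {H. subgraph H G \<and> isomorphic T H}"

definition free_of :: "'a sgraph \<Rightarrow> 'b sgraph \<Rightarrow> bool" where
  "free_of F G \<longleftrightarrow> \<not> (\<exists>H. subgraph H G \<and> isomorphic F H)"

definition proper_coloring :: "'a sgraph \<Rightarrow> nat \<Rightarrow> ('a \<Rightarrow> nat) \<Rightarrow> bool" where
  "proper_coloring G k c \<longleftrightarrow>
     (\<forall>v\<in>verts G. c v < k) \<and> (\<forall>u v. {u, v} \<in> edges G \<longrightarrow> c u \<noteq> c v)"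

definition chromatic_number :: "'a sgraph \<Rightarrow> nat" where
  "chromatic_number G = (LEAST k. \<exists>c. proper_coloring G k c)"

(* Host graphs have vertices in nat; every finite graph is isomorphic to such a graph, so this
   does not restrict the number of vertices or anything else that matters here.
   Max is taken over a finite nonempty set whenever T has no isolated vertices (a copy of T is
   then determined by its set of edges, so there are at most 2 ^ m copies) and F is not
   bipartite (m disjoint edges then form an F-free graph). *)
definition mex :: "'a sgraph \<Rightarrow> nat \<Rightarrow> 'b sgraph \<Rightarrow> nat" where
  "mex T m F =
     Max {card (copies T G) | G :: nat sgraph.
            finite_simple_graph G \<and> card (edges G) = m \<and> free_of F G}"

end

theory Submission
  imports Defs
begin

text \<open>If \<open>F\<close> has chromatic number \<open>r + 1\<close>, then the maximum is \<open>c m\<^bsup>s/2\<^esup> + o(m\<^bsup>s/2\<^esup>)\<close> with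
  \<open>c = C(r,s) / C(r,2)\<^bsup>s/2\<^esup>\<close>. As this depends on \<open>r\<close> only, it also holds for the complete graph on
  \<open>r + 1\<close> vertices and the two maxima differ by \<open>o(m\<^bsup>s/2\<^esup>)\<close>.

  The lower bound comes from a balanced complete \<open>r\<close>-partite graph, completed to \<open>m\<close> edges by a matching.
  For the upper bound, vertices of degree below \<open>\<eta> m\<^bsup>1/2\<^esup>\<close> lie in few \<open>(r+1)\<close>-cliques, and the
  remaining \<open>O(m\<^bsup>1/2\<^esup>)\<close> vertices span \<open>o(m\<^bsup>(r+1)/2\<^esup>)\<close> of them by Erdos' theorem.
  Now put weights on the vertices. Zykov symmetrization with the
  edge weight kept constant does not decrease the \<open>s\<close>-clique weight minus \<open>\<mu>\<close> times the
  \<open>(r+1)\<close>-clique weight, and ends on a clique, where clique weights are elementary symmetric polynomials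
  \<open>e\<^sub>k\<close>. If \<open>e\<^bsub>r+1\<^esub>\<close> is small there, almost all the weight sits on \<open>r\<close> vertices, and Maclaurin's
  inequality bounds \<open>e\<^sub>s\<close> by \<open>c e\<^sub>2\<^bsup>s/2\<^esup>\<close> up to an error term.\<close>

section \<open>Elementary symmetric polynomials\<close>

definition esym :: "'a set \<Rightarrow> ('a \<Rightarrow> real) \<Rightarrow> nat \<Rightarrow> real" where
  "esym X x k = (\<Sum>S\<in>nsets X k. \<Prod>v\<in>S. x v)"

lemma nsets_insert_Suc:
  assumes "a \<notin> X"
  shows "nsets (insert a X) (Suc k) = nsets X (Suc k) \<union> insert a ` nsets X k"
proof (intro equalityI subsetI)
  fix S assume S: "S \<in> nsets (insert a X) (Suc k)"
  show "S \<in> nsets X (Suc k) \<union> insert a ` nsets X k"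
  proof (cases "a \<in> S")
    case True
    then have "S = insert a (S - {a})" "S - {a} \<in> nsets X k"
      using S by (auto simp: nsets_def)
    then show ?thesis by blast
  qed (use S in \<open>auto simp: nsets_def\<close>)
qed (use assms in \<open>auto simp: nsets_def card_insert_if finite_subset\<close>)

lemma esym_0 [simp]: "esym X x 0 = 1"
  by (simp add: esym_def)

lemma esym_empty_Suc [simp]: "esym {} x (Suc k) = 0"
  by (simp add: esym_def nsets_def)

lemma esym_insert_Suc:
  assumes "finite X" "a \<notin> X"
  shows "esym (insert a X) x (Suc k) = esym X x (Suc k) + x a * esym X x k"
proof -
  have inj: "inj_on (insert a) (nsets X k)"
    using assms(2) unfolding inj_on_def nsets_def
    by (metis (mono_tags, lifting) insert_ident mem_Collect_eq subsetD)
  have "esym (insert a X) x (Suc k) =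
      esym X x (Suc k) + (\<Sum>S\<in>insert a ` nsets X k. \<Prod>v\<in>S. x v)"
    unfolding esym_def nsets_insert_Suc[OF assms(2)]
    by (rule sum.union_disjoint) (use assms in \<open>auto simp: nsets_def finite_imp_finite_nsets\<close>)
  also have "(\<Sum>S\<in>insert a ` nsets X k. \<Prod>v\<in>S. x v) = (\<Sum>S\<in>nsets X k. x a * (\<Prod>v\<in>S. x v))"
    unfolding sum.reindex[OF inj] o_def
    by (rule sum.cong[OF refl], rule prod.insert) (use assms in \<open>auto simp: nsets_def\<close>)
  finally show ?thesis by (simp add: esym_def sum_distrib_left)
qed

lemma esym_nonneg:
  assumes "\<And>v. v \<in> X \<Longrightarrow> x v \<ge> 0"
  shows "esym X x k \<ge> 0"
  unfolding esym_def by (intro sum_nonneg prod_nonneg) (use assms in \<open>auto simp: nsets_def\<close>)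

text \<open>The inductive step of Newton's inequalities, with \<open>A, B, C, D\<close> four consecutive elementary
  symmetric polynomials and \<open>x\<close> the new variable: the slack in the coefficients of \<open>1\<close> and \<open>x\<^sup>2\<close>
  and the excess in that of \<open>x\<close> combine to a perfect square.\<close>

lemma newton_step:
  fixes A B C D x k j :: real
  assumes "A \<ge> 0" "B \<ge> 0" "C \<ge> 0" "D \<ge> 0" "x \<ge> 0" "k \<ge> 1" "j \<ge> 0"
    and BD: "(k+1) * (j+1) * (B * D) \<le> k * j * C^2"
    and AC: "k * (j+2) * (A * C) \<le> (k-1) * (j+1) * B^2"
    and AD: "(k+1) * (j+2) * (A * D) \<le> (k-1) * j * (B * C)"
  shows "(k+1) * (j+2) * ((B + x * A) * (D + x * C)) \<le> k * (j+1) * (C + x * B)^2"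
proof -
  have 1: "(k+1) * (j+2) * (B * D) \<le> k * (j+1) * C^2 - k * C^2 / (j+1)"
  proof -
    have "(k+1) * (j+2) * (B * D) = (j+2)/(j+1) * ((k+1) * (j+1) * (B * D))"
      using assms by (simp add: field_simps)
    also have "\<dots> \<le> (j+2)/(j+1) * (k * j * C^2)"
      by (rule mult_left_mono[OF BD]) (use assms in auto)
    also have "\<dots> = k * (j+1) * C^2 - k * C^2 / (j+1)"
      using assms by (simp add: field_simps)
    finally show ?thesis .
  qed
  have 2: "(k+1) * (j+2) * (A * C) \<le> k * (j+1) * B^2 - (j+1) * B^2 / k"
  proof -
    have "(k+1) * (j+2) * (A * C) = (k+1)/k * (k * (j+2) * (A * C))"
      using assms by (simp add: field_simps)
    also have "\<dots> \<le> (k+1)/k * ((k-1) * (j+1) * B^2)"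
      by (rule mult_left_mono[OF AC]) (use assms in auto)
    also have "\<dots> = k * (j+1) * B^2 - (j+1) * B^2 / k"
      using assms by (simp add: field_simps power2_eq_square)
    finally show ?thesis .
  qed
  have sq: "0 \<le> k * C^2 / (j+1) + x^2 * ((j+1) * B^2 / k) - 2 * x * (B * C)"
  proof -
    have "0 \<le> (k * C - x * (j+1) * B)^2 / (k * (j+1))"
      using assms by auto
    also have "\<dots> = k * C^2 / (j+1) + x^2 * ((j+1) * B^2 / k) - 2 * x * (B * C)"
      using assms by (simp add: divide_simps) (simp add: power2_eq_square algebra_simps)
    finally show ?thesis .
  qed
  have "(k+1) * (j+2) * ((B + x * A) * (D + x * C)) =
      (k+1) * (j+2) * (B * D) + x * ((k+1) * (j+2) * (B * C)) + x * ((k+1) * (j+2) * (A * D))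
       + x^2 * ((k+1) * (j+2) * (A * C))"
    by (simp add: algebra_simps power2_eq_square)
  also have "\<dots> \<le> (k * (j+1) * C^2 - k * C^2 / (j+1)) + x * ((k+1) * (j+2) * (B * C))
      + x * ((k-1) * j * (B * C)) + x^2 * (k * (j+1) * B^2 - (j+1) * B^2 / k)"
    by (intro add_mono 1 mult_left_mono[OF 2] mult_left_mono[OF AD]) (use assms in auto)
  also have "\<dots> = k * (j+1) * (C + x * B)^2
      - (k * C^2 / (j+1) + x^2 * ((j+1) * B^2 / k) - 2 * x * (B * C))"
    by (simp add: algebra_simps power2_eq_square)
  also have "\<dots> \<le> k * (j+1) * (C + x * B)^2" using sq by simp
  finally show ?thesis .
qed

lemma esym_eq_0:
  assumes "card X < k" "finite X"
  shows "esym X x k = 0"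
proof -
  have "nsets X k = {}" using assms by (simp add: nsets_eq_empty_iff)
  then show ?thesis by (simp add: esym_def)
qed

text \<open>A vanishing sum of nonnegative products has all products zero, and each longer product
  contains a shorter one. This settles the cases where the arguments of Newton and Maclaurin would
  divide by zero.\<close>

lemma esym_Suc_eq_0:
  assumes "finite X" "\<And>v. v \<in> X \<Longrightarrow> x v \<ge> 0" "esym X x k = 0"
  shows "esym X x (Suc k) = 0"
proof -
  have "(\<Prod>v\<in>S. x v) = 0" if S: "S \<in> nsets X (Suc k)" for S
  proof -
    from S obtain a where a: "a \<in> S" by (auto simp: nsets_def card_Suc_eq)
    with S have T: "S - {a} \<in> nsets X k" by (auto simp: nsets_def)
    have "\<forall>T\<in>nsets X k. (\<Prod>v\<in>T. x v) = 0"
      using assms(3) unfolding esym_def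
      by (subst (asm) sum_nonneg_eq_0_iff)
         (use assms in \<open>auto simp: finite_imp_finite_nsets nsets_def intro!: prod_nonneg\<close>)
    then have "(\<Prod>v\<in>S - {a}. x v) = 0" using T by blast
    then show ?thesis
      using a S by (subst prod.remove[OF _ a]) (auto simp: nsets_def)
  qed
  then show ?thesis by (simp add: esym_def)
qed

text \<open>Allowing more places than variables (\<open>card X \<le> k + j + 1\<close>) saves padding with zeros later.\<close>

lemma newton_esym:
  assumes "finite X" "\<And>v. v \<in> X \<Longrightarrow> x v \<ge> 0" "card X \<le> k + j + 1"
  shows "(real k + 2) * (real j + 1) * (esym X x k * esym X x (k + 2))
    \<le> (real k + 1) * real j * (esym X x (k + 1))^2"
  using assms
proof (induction X arbitrary: k j rule: finite_induct)
  case empty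
  then show ?case by simp
next
  case (insert a X)
  show ?case
  proof (cases j)
    case 0
    then show ?thesis
      using insert by (simp add: esym_eq_0)
  next
    case (Suc i)
    \<comment> \<open>\<open>A\<close> stands for the polynomial of index \<open>k - 1\<close>. At
      \<open>k = 0\<close> it must be zero, whereas truncated subtraction would turn it into
      \<open>esym X x 0 = 1\<close>.\<close>
    define A where "A = (if k = 0 then 0 else esym X x (k - 1))"
    define B C D where "B = esym X x k" "C = esym X x (k + 1)" "D = esym X x (k + 2)"
    note d = A_def B_C_D_def
    have nn: "A \<ge> 0" "B \<ge> 0" "C \<ge> 0" "D \<ge> 0"
      unfolding d by (auto intro!: esym_nonneg insert.prems)
    have BD: "(real k + 1 + 1) * (real i + 1) * (B * D) \<le> (real k + 1) * real i * C^2"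
      using insert.IH[of k i] insert.prems insert.hyps Suc by (simp add: d add_ac)
    have AC: "(real k + 1) * (real i + 2) * (A * C) \<le> (real k + 1 - 1) * (real i + 1) * B^2"
    proof (cases k)
      case (Suc l)
      then show ?thesis
        using insert.IH[of l "i + 1"] insert.prems insert.hyps \<open>j = Suc i\<close> by (simp add: d add_ac)
    qed (simp add: d)
    \<comment> \<open>Multiply \<open>BD\<close> by \<open>AC\<close> and cancel a positive multiple
      of \<open>B * C\<close>; if that product vanishes, so does \<open>D\<close>.\<close>
    have AD: "(real k + 1 + 1) * (real i + 2) * (A * D) \<le> (real k + 1 - 1) * real i * (B * C)"
    proof (cases "B * C = 0")
      case True
      then have "D = 0"
        using esym_Suc_eq_0[OF insert.hyps(1), of x] insert.prems(1) unfolding d by force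
      then show ?thesis using nn by simp
    next
      case False
      then have pos: "0 < (real k + 1) * (real i + 1) * (B * C)" using nn by (auto simp: less_le)
      have "((real k + 1 + 1) * (real i + 2) * (A * D)) * ((real k + 1) * (real i + 1) * (B * C))
        = ((real k + 1 + 1) * (real i + 1) * (B * D)) * ((real k + 1) * (real i + 2) * (A * C))"
        by (simp only: mult_ac)
      also have "\<dots> \<le> ((real k + 1) * real i * C^2) * ((real k + 1 - 1) * (real i + 1) * B^2)"
        by (rule mult_mono[OF BD AC]) (use nn in auto)
      also have "\<dots> = ((real k + 1 - 1) * real i * (B * C)) * ((real k + 1) * (real i + 1) * (B * C))"
        by (simp only: mult_ac power2_eq_square)
      finally show ?thesis using pos by (simp only: mult_le_cancel_right_pos)
    qed
    have "(real k + 1 + 1) * (real i + 2) * ((B + x a * A) * (D + x a * C))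
        \<le> (real k + 1) * (real i + 1) * (C + x a * B)^2"
      by (rule newton_step[OF nn _ _ _ BD AC AD]) (use insert.prems in auto)
    moreover have "esym (insert a X) x k = B + x a * A"
      using esym_insert_Suc[OF insert.hyps(1,2), of x "k - 1"] by (cases k) (auto simp: d)
    moreover have "esym (insert a X) x (k + 1) = C + x a * B" "esym (insert a X) x (k + 2) = D + x a * C"
      using esym_insert_Suc[OF insert.hyps(1,2), of x] by (auto simp: d)
    ultimately show ?thesis using Suc by (simp add: add_ac)
  qed
qed

text \<open>Newton's inequalities say that the normalized polynomials \<open>p k\<close> are
  log-concave, and \<open>p 0 = 1\<close>; hence the \<open>k\<close>-th roots of \<open>p k\<close>
  decrease. \<open>N\<close> need only bound the number of variables, as if they were padded with
  zeros.\<close>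

lemma maclaurin_esym:
  assumes "finite X" "\<And>v. v \<in> X \<Longrightarrow> x v \<ge> 0" "card X \<le> N" "2 \<le> s" "2 \<le> N"
  shows "esym X x s \<le> real (N choose s) * sqrt (esym X x 2 / real (N choose 2)) ^ s"
proof (cases "s \<le> N")
  case False
  then show ?thesis using assms by (simp add: esym_eq_0 binomial_eq_0)
next
  case True
  define p where "p k = esym X x k / real (N choose k)" for k
  have p0: "p k \<ge> 0" for k
    unfolding p_def by (intro divide_nonneg_nonneg esym_nonneg assms) auto
  have newton: "p k * p (k + 2) \<le> (p (k + 1))^2" if "k + 2 \<le> N" for k
  proof -
    \<comment> \<open>With \<open>k + j + 1 = N\<close> the factors in \<open>newton_esym\<close>
      are exactly those relating consecutive binomial coefficients.\<close>
    define j where "j = N - (k + 1)"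
    have N: "N = k + j + 1" "j > 0" using that by (auto simp: j_def)
    define a b c where "a = real (N choose k)" "b = real (N choose (k + 1))" "c = real (N choose (k + 2))"
    have pos: "a > 0" "b > 0" "c > 0" using that by (auto simp: a_b_c_def)
    have "Suc k * (N choose Suc k) = (N - k) * (N choose k)"
      using binomial_absorb_comp[of N k] binomial_absorption[of k N] by simp
    then have "real (Suc k * (N choose Suc k)) = real ((N - k) * (N choose k))" by (simp only:)
    then have ab: "(real k + 1) * b = (real j + 1) * a"
      using N by (simp add: a_b_c_def algebra_simps)
    have "Suc (Suc k) * (N choose Suc (Suc k)) = (N - Suc k) * (N choose Suc k)"
      using binomial_absorb_comp[of N "Suc k"] binomial_absorption[of "Suc k" N] by simp
    then have "real (Suc (Suc k) * (N choose Suc (Suc k))) = real ((N - Suc k) * (N choose Suc k))" 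
      by (simp only:)
    then have bc: "(real k + 2) * c = real j * b"
      using N by (simp add: a_b_c_def algebra_simps)
    have "(real k + 2) * (real j + 1) * (esym X x k * esym X x (k + 2))
       \<le> (real k + 1) * real j * (esym X x (k + 1))^2"
      by (rule newton_esym) (use assms N in auto)
    then have "(real k + 2) * (real j + 1) * ((a * p k) * (c * p (k + 2)))
       \<le> (real k + 1) * real j * (b * p (k + 1))^2"
      using pos by (simp add: p_def a_b_c_def)
    also have "(real k + 2) * (real j + 1) * ((a * p k) * (c * p (k + 2))) 
        = ((real j + 1) * a) * ((real k + 2) * c) * (p k * p (k + 2))"
      by (simp only: mult_ac)
    also have "\<dots> = ((real k + 1) * real j * b^2) * (p k * p (k + 2))"
      unfolding ab[symmetric] bc by (simp add: power2_eq_square)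
    finally have "((real k + 1) * real j * b^2) * (p k * p (k + 2))
        \<le> ((real k + 1) * real j * b^2) * (p (k + 1))^2" 
      by (simp add: power_mult_distrib mult_ac)
    moreover have "0 < (real k + 1) * real j * b^2" using N pos by auto
    ultimately show ?thesis by (simp only: mult_le_cancel_left_pos)
  qed
  \<comment> \<open>Monotonicity of the roots with exponents cleared. Log-concavity raised to the
    power \<open>k + 1\<close> meets the induction hypothesis, and \<open>p (k + 1) ^ k\<close>
    cancels.\<close>
  have step: "p (k + 1) ^ k \<le> p k ^ (k + 1)" if "k + 1 \<le> N" for k
    using that
  proof (induction k)
    case 0
    then show ?case by (simp add: p_def)
  next
    case (Suc k)
    let ?q = "p (k + 1)"
    show ?case
    proof (cases "?q = 0")
      case True
      then have "p (k + 2) = 0"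
        using esym_Suc_eq_0[of X x "k+1"] assms Suc.prems by (simp add: p_def)
      then show ?thesis using True by simp
    next
      case False
      then have pos: "?q ^ k > 0" using p0[of "k+1"] by simp
      have "p (k + 2) ^ (k + 1) * ?q ^ k \<le> p (k + 2) ^ (k + 1) * p k ^ (k + 1)"
        by (rule mult_left_mono) (use Suc p0 in auto)
      also have "\<dots> = (p k * p (k + 2)) ^ (k + 1)" by (simp add: power_mult_distrib)
      also have "\<dots> \<le> (?q^2) ^ (k + 1)"
        by (rule power_mono[OF newton]) (use Suc p0 in auto)
      also have "\<dots> = ?q ^ (k + 2) * ?q ^ k"
        unfolding power_mult[symmetric] power_add[symmetric] by (simp add: mult_2)
      finally show ?thesis using pos by (simp add: mult_le_cancel_right_pos)
    qed
  qed
  \<comment> \<open>Chains the root comparisons from index 2 upwards. Both sides are raised to the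
    power \<open>t\<close>, which is cancelled at the end.\<close>
  have "p t ^ 2 \<le> p 2 ^ t" if "2 \<le> t" "t \<le> N" for t
    using that
  proof (induction t rule: dec_induct)
    case (step t)
    have "(p (Suc t) ^ 2) ^ t = (p (Suc t) ^ t) ^ 2"
      by (simp only: power_mult[symmetric] mult.commute)
    also have "\<dots> \<le> (p t ^ (t + 1)) ^ 2"
      by (rule power_mono) (use \<open>\<And>k. k + 1 \<le> N \<Longrightarrow> _\<close>[of t] step p0 in auto)
    also have "\<dots> = (p t ^ 2) ^ (t + 1)"
      by (simp only: power_mult[symmetric] mult.commute)
    also have "\<dots> \<le> (p 2 ^ t) ^ (t + 1)"
      by (rule power_mono) (use step in auto)
    also have "\<dots> = (p 2 ^ Suc t) ^ t"
      by (simp only: power_mult[symmetric] mult.commute Suc_eq_plus1)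
    finally show ?case 
      by (rule power_mono_iff[THEN iffD1, rotated -1]) (use step p0 in auto)
  qed simp
  from this[OF \<open>2 \<le> s\<close> True] have "p s ^ 2 \<le> p 2 ^ s" .
  also have "p 2 ^ s = (sqrt (p 2) ^ 2) ^ s"
    using p0[of 2] by simp
  also have "\<dots> = (sqrt (p 2) ^ s) ^ 2"
    by (simp only: power_mult[symmetric] mult.commute)
  finally have "p s \<le> sqrt (p 2) ^ s"
    by (rule power2_le_imp_le) (use p0 in auto)
  then show ?thesis
    using True by (simp add: p_def field_simps)
qed

text \<open>The number of variables cancels, because \<open>N choose s\<close> is at most
  \<open>N ^ s\<close> while \<open>N choose 2\<close> is at least \<open>(N / 2)^2\<close>. A
  weaker constant buys a bound uniform in \<open>X\<close>.\<close>

lemma maclaurin_esym_crude: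
  assumes "finite X" "\<And>v. v \<in> X \<Longrightarrow> x v \<ge> 0" "2 \<le> s"
  shows "esym X x s \<le> 2 ^ s * sqrt (esym X x 2) ^ s"
proof -
  \<comment> \<open>The summand 2 guarantees \<open>N \<ge> 2\<close>, even for empty
    \<open>X\<close>.\<close>
  define N where "N = card X + 2"
  have e0: "esym X x 2 \<ge> 0" by (rule esym_nonneg) (use assms in auto)
  have "esym X x s \<le> real (N choose s) * sqrt (esym X x 2 / real (N choose 2)) ^ s"
    by (rule maclaurin_esym) (use assms in \<open>auto simp: N_def\<close>)
  also have "\<dots> \<le> real N ^ s * sqrt (esym X x 2 / ((real N / 2)^2)) ^ s"
  proof (rule mult_mono)
    have "N choose s \<le> (N choose s) * fact s" by simp
    also have "\<dots> \<le> N ^ s" by (rule binomial_fact_pow)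
    finally show "real (N choose s) \<le> real N ^ s" unfolding of_nat_power[symmetric] of_nat_le_iff .
    have "(real N / 2) ^ 2 \<le> real (N choose 2)"
      using binomial_ge_n_over_k_pow_k[of 2 N, where 'a = real] by (simp add: N_def)
    then show "sqrt (esym X x 2 / real (N choose 2)) ^ s \<le> sqrt (esym X x 2 / ((real N / 2)^2)) ^ s"
      by (intro power_mono real_sqrt_le_mono divide_left_mono) (use e0 in \<open>auto simp: N_def\<close>)
  qed (use e0 in auto)
  also have "\<dots> = (real N * sqrt (esym X x 2 / ((real N / 2)^2))) ^ s" 
    by (simp add: power_mult_distrib)
  also have "real N * sqrt (esym X x 2 / ((real N / 2)^2)) = 2 * sqrt (esym X x 2)"
    by (simp add: real_sqrt_divide N_def)
  finally show ?thesis by (simp add: power_mult_distrib)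
qed

section \<open>Weighted symmetrization\<close>

text \<open>\<open>E\<close> is not confined to pairs from \<open>V\<close>, so vertices can be
  deleted by shrinking \<open>V\<close> while \<open>E\<close> stays fixed.\<close>

definition cliques :: "'a set set \<Rightarrow> 'a set \<Rightarrow> nat \<Rightarrow> 'a set set" where
  "cliques E V k = {S \<in> nsets V k. nsets S 2 \<subseteq> E}"

definition clique_weight :: "'a set set \<Rightarrow> 'a set \<Rightarrow> ('a \<Rightarrow> real) \<Rightarrow> nat \<Rightarrow> real" where
  "clique_weight E V x k = (\<Sum>S\<in>cliques E V k. \<Prod>v\<in>S. x v)"

text \<open>This is the partial derivative of \<open>clique_weight\<close> in the variable
  \<open>x u\<close>; for \<open>k = 2\<close> it is the weighted degree of
  \<open>u\<close>.\<close>

definition link_weight :: "'a set set \<Rightarrow> 'a set \<Rightarrow> ('a \<Rightarrow> real) \<Rightarrow> nat \<Rightarrow> 'a \<Rightarrow> real" where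
  "link_weight E V x k u = (\<Sum>S\<in>{S \<in> cliques E V k. u \<in> S}. \<Prod>v\<in>S - {u}. x v)"

lemma finite_cliques [simp]: "finite V \<Longrightarrow> finite (cliques E V k)"
  by (simp add: cliques_def finite_imp_finite_nsets)

lemma in_cliques_iff:
  "S \<in> cliques E V k \<longleftrightarrow> S \<subseteq> V \<and> finite S \<and> card S = k \<and> nsets S 2 \<subseteq> E"
  unfolding cliques_def nsets_def by blast

lemma cliques_finite_mem: "S \<in> cliques E V k \<Longrightarrow> finite S"
  by (simp add: in_cliques_iff)

lemma clique_weight_remove:
  assumes "finite V"
  shows "clique_weight E V x k = clique_weight E (V - {u}) x k + x u * link_weight E V x k u"
proof -
  have eq: "cliques E V k = cliques E (V - {u}) k \<union> {S \<in> cliques E V k. u \<in> S}"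
    by (intro set_eqI) (simp only: Un_iff mem_Collect_eq in_cliques_iff, blast)
  have disj: "cliques E (V - {u}) k \<inter> {S \<in> cliques E V k. u \<in> S} = {}"
    unfolding in_cliques_iff disjoint_iff by blast
  have "clique_weight E V x k = 
      clique_weight E (V - {u}) x k + (\<Sum>S\<in>{S \<in> cliques E V k. u \<in> S}. \<Prod>v\<in>S. x v)"
    unfolding clique_weight_def using assms disj
    by (subst eq, subst sum.union_disjoint) auto
  also have "(\<Sum>S\<in>{S \<in> cliques E V k. u \<in> S}. \<Prod>v\<in>S. x v) = x u * link_weight E V x k u"
    unfolding link_weight_def sum_distrib_left
    by (intro sum.cong refl prod.remove) (auto dest: cliques_finite_mem)
  finally show ?thesis .
qed

lemma clique_weight_cong:
  "(\<And>v. v \<in> V \<Longrightarrow> x v = y v) \<Longrightarrow> clique_weight E V x k = clique_weight E V y k"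
  unfolding clique_weight_def cliques_def nsets_def by (intro sum.cong prod.cong refl) auto

text \<open>No clique contains both \<open>u\<close> and \<open>v\<close>, so deleting
  \<open>u\<close> leaves the cliques through \<open>v\<close> and their link weight intact, and the
  weight is affine in \<open>x v\<close>.\<close>

lemma clique_weight_transfer:
  assumes "finite V" "u \<noteq> v" "{u, v} \<notin> E"
  shows "clique_weight E (V - {u}) (x(v := x v + t)) k
    = clique_weight E (V - {u}) x k + t * link_weight E V x k v"
proof -
  have "u \<notin> S" if "S \<in> cliques E V k" "v \<in> S" for S
  proof
    assume "u \<in> S"
    then have "{u, v} \<in> nsets S 2" using that assms(2) by simp
    then show False using that assms(3) unfolding cliques_def by blast
  qed
  then have eq: "{S \<in> cliques E (V - {u}) k. v \<in> S} = {S \<in> cliques E V k. v \<in> S}"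
    by (intro set_eqI) (simp only: mem_Collect_eq in_cliques_iff, blast)
  have link: "link_weight E (V - {u}) (x(v := a)) k v = link_weight E V x k v" for a
    unfolding link_weight_def eq by (intro sum.cong prod.cong refl) auto
  have rest: "clique_weight E (V - {u} - {v}) (x(v := a)) k = clique_weight E (V - {u} - {v}) x k" for a
    by (rule clique_weight_cong) auto
  have "clique_weight E (V - {u}) (x(v := a)) k
      = clique_weight E (V - {u} - {v}) x k + a * link_weight E V x k v" for a
    using assms(1) by (subst clique_weight_remove[where u = v]) (auto simp: link rest)
  from this[of "x v + t"] this[of "x v"] show ?thesis by (simp add: algebra_simps)
qed

lemma link_weight_nonneg:
  assumes "\<And>v. v \<in> V \<Longrightarrow> x v \<ge> 0"
  shows "link_weight E V x k u \<ge> 0"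
  unfolding link_weight_def
  by (intro sum_nonneg prod_nonneg) (use assms in \<open>force simp: in_cliques_iff\<close>)

text \<open>Zero weighted degree forces weight zero on every neighbour of \<open>u\<close>, and each
  clique through \<open>u\<close> with at least two vertices contains a neighbour. Such a
  \<open>u\<close> can be deleted at no cost.\<close>

lemma link_weight_eq_0:
  assumes "finite V" "\<And>v. v \<in> V \<Longrightarrow> x v \<ge> 0" "link_weight E V x 2 u = 0" "k \<ge> 2"
  shows "link_weight E V x k u = 0"
  unfolding link_weight_def
proof (rule sum.neutral, rule ballI)
  fix S assume S: "S \<in> {S \<in> cliques E V k. u \<in> S}"
  have "\<not> S \<subseteq> {u}"
  proof
    assume "S \<subseteq> {u}"
    then have "card S \<le> card {u}" by (intro card_mono) auto
    then show False using S assms(4) by (simp add: in_cliques_iff)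
  qed
  then obtain w where w: "w \<in> S" "w \<noteq> u" by blast
  have "{u, w} \<subseteq> S" using S w by simp
  then have "nsets {u, w} 2 \<subseteq> nsets S 2" by (rule nsets_mono)
  also have "\<dots> \<subseteq> E" using S by (simp add: in_cliques_iff)
  finally have "nsets {u, w} 2 \<subseteq> E" .
  moreover have "S \<subseteq> V" using S by (simp add: in_cliques_iff)
  then have "u \<in> V" "w \<in> V" using \<open>{u, w} \<subseteq> S\<close> by blast+
  ultimately have uw: "{u, w} \<in> {S \<in> cliques E V 2. u \<in> S}"
    unfolding in_cliques_iff using \<open>w \<noteq> u\<close> by simp
  have "0 \<le> (\<Prod>v\<in>S - {u}. x v)" if "S \<in> {S \<in> cliques E V 2. u \<in> S}" for S
    by (intro prod_nonneg) (use that assms(2) in \<open>force simp: in_cliques_iff\<close>)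
  then have "(\<Sum>S\<in>{S \<in> cliques E V 2. u \<in> S}. \<Prod>v\<in>S - {u}. x v) = 0 \<longleftrightarrow>
      (\<forall>S\<in>{S \<in> cliques E V 2. u \<in> S}. (\<Prod>v\<in>S - {u}. x v) = 0)"
    using assms(1) by (intro sum_nonneg_eq_0_iff) simp_all
  then have "(\<Prod>v\<in>{u, w} - {u}. x v) = 0"
    using uw assms(3) unfolding link_weight_def by blast
  moreover have "{u, w} - {u} = {w}" using w by blast
  ultimately have "x w = 0" by simp
  moreover have "finite (S - {u})" "w \<in> S - {u}" using w S by (simp_all add: in_cliques_iff)
  ultimately show "(\<Prod>v\<in>S - {u}. x v) = 0" by (intro prod_zero) blast+
qed

lemma clique_weight_complete:
  assumes "nsets K 2 \<subseteq> E"
  shows "clique_weight E K x k = esym K x k"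
proof -
  have "nsets S 2 \<subseteq> E" if "S \<in> nsets K k" for S
    by (rule order_trans[OF nsets_mono assms]) (use that in \<open>simp add: nsets_def\<close>)
  then have "cliques E K k = nsets K k" by (auto simp: cliques_def)
  then show ?thesis by (simp add: clique_weight_def esym_def)
qed

text \<open>Along the line in the plane \<open>(x u, x v)\<close> on which the weight of the edges is constant, all clique
  weights are affine because no clique contains both \<open>u\<close> and \<open>v\<close>; so the endpoint at which
  \<open>x u\<close> vanishes is at least as good if \<open>u\<close> is the worse of the two vertices.\<close>

lemma symmetrization_step:
  fixes E :: "'a set set" and x :: "'a \<Rightarrow> real" and V :: "'a set" and \<mu> :: real and s q :: nat
  defines "D \<equiv> link_weight E V x 2"
    and "\<phi> \<equiv> (\<lambda>w. link_weight E V x s w - \<mu> * link_weight E V x q w)"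
  assumes "finite V" "v \<in> V" "u \<noteq> v" "{u, v} \<notin> E"
    and nn: "\<And>v. v \<in> V \<Longrightarrow> x v \<ge> 0" "u \<in> V"
    and "s \<ge> 2" "q \<ge> 2"
    and *: "D u = 0 \<or> D v > 0 \<and> \<phi> u * D v \<le> \<phi> v * D u"
  obtains y where "\<And>v. v \<in> V - {u} \<Longrightarrow> y v \<ge> 0"
    "clique_weight E (V - {u}) y 2 = clique_weight E V x 2"
    "clique_weight E V x s - \<mu> * clique_weight E V x q
      \<le> clique_weight E (V - {u}) y s - \<mu> * clique_weight E (V - {u}) y q"
proof (cases "D u = 0")
  case True
  then have "link_weight E V x k u = 0" if "k \<ge> 2" for k
    using link_weight_eq_0[OF \<open>finite V\<close>, of x E u k] nn that by (simp add: D_def)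
  then show ?thesis
    using assms by (intro that[of x]) (auto simp: clique_weight_remove[OF \<open>finite V\<close>, of E x _ u])
next
  case False
  with * have Dv: "D v > 0" and le: "\<phi> u * D v \<le> \<phi> v * D u" by auto
  \<comment> \<open>Weight \<open>t\<close> moved to \<open>v\<close> restores exactly the edge
    weight \<open>x u * D u\<close> that disappears with \<open>u\<close>.\<close>
  define t where "t = x u * D u / D v"
  have "D u \<ge> 0" unfolding D_def by (rule link_weight_nonneg) (use nn in auto)
  then have "t \<ge> 0" using Dv nn by (simp add: t_def)
  have rem: "clique_weight E V x k = clique_weight E (V - {u}) x k + x u * link_weight E V x k u" for k
    by (rule clique_weight_remove) fact
  define y where "y = x(v := x v + t)"
  have tr: "clique_weight E (V - {u}) y k
    = clique_weight E (V - {u}) x k + t * link_weight E V x k v" for k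
    unfolding y_def by (rule clique_weight_transfer) fact+
  have y0: "y w \<ge> 0" if "w \<in> V" for w
    using that nn(1) \<open>v \<in> V\<close> \<open>t \<ge> 0\<close> by (simp add: y_def)
  have "x u * \<phi> u * D v \<le> x u * \<phi> v * D u" 
    using mult_left_mono[OF le nn(1)[OF nn(2)]] by (simp only: mult_ac)
  then have "x u * \<phi> u \<le> t * \<phi> v"
    using Dv by (simp add: t_def field_simps)
  moreover have "t * D v = x u * D u" using Dv by (simp add: t_def)
  ultimately show ?thesis
    using y0 by (intro that[of y]) (auto simp: rem tr D_def \<phi>_def algebra_simps)
qed

text \<open>Repeat \<open>symmetrization_step\<close>, which deletes a vertex each time, until the
  remaining vertices are pairwise adjacent.\<close>

lemma symmetrization:
  assumes "finite V" "\<And>v. v \<in> V \<Longrightarrow> x v \<ge> 0" "s \<ge> 2" "q \<ge> 2"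
  obtains K y where "K \<subseteq> V" "nsets K 2 \<subseteq> E" "\<And>v. v \<in> K \<Longrightarrow> y v \<ge> 0"
    "esym K y 2 = clique_weight E V x 2"
    "clique_weight E V x s - \<mu> * clique_weight E V x q \<le> esym K y s - \<mu> * esym K y q"
proof -
  have "\<exists>K y. K \<subseteq> V \<and> nsets K 2 \<subseteq> E \<and> (\<forall>v\<in>K. y v \<ge> 0) \<and> esym K y 2 = clique_weight E V x 2
    \<and> clique_weight E V x s - \<mu> * clique_weight E V x q \<le> esym K y s - \<mu> * esym K y q"
    using assms(1,2)
  proof (induction V arbitrary: x rule: finite_psubset_induct)
    case (psubset V)
    show ?case
    proof (cases "nsets V 2 \<subseteq> E")
      case True
      then show ?thesis using psubset.prems
        by (intro exI[of _ V] exI[of _ x]) (auto simp: clique_weight_complete)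
    next
      case False
      then obtain a b where ab: "a \<in> V" "b \<in> V" "a \<noteq> b" "{a, b} \<notin> E"
        by (auto simp: nsets_2_eq)
      define D where "D = link_weight E V x 2"
      define \<phi> where "\<phi> w = link_weight E V x s w - \<mu> * link_weight E V x q w" for w
      have D0: "D w \<ge> 0" for w unfolding D_def by (rule link_weight_nonneg) (use psubset in auto)
      \<comment> \<open>Of two nonadjacent vertices the one with the smaller ratio of
        \<open>\<phi>\<close> to \<open>D\<close> is deleted, compared after cross-multiplication; a
        vertex with \<open>D = 0\<close> is deleted outright.\<close>
      have "\<exists>u v. u \<in> V \<and> v \<in> V \<and> u \<noteq> v \<and> {u, v} \<notin> E
        \<and> (D u = 0 \<or> D v > 0 \<and> \<phi> u * D v \<le> \<phi> v * D u)"
      proof (cases "D b = 0 \<or> (D a > 0 \<and> \<phi> b * D a \<le> \<phi> a * D b)")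
        case True
        then show ?thesis using ab by (intro exI[of _ b] exI[of _ a]) (auto simp: insert_commute)
      next
        case False
        then show ?thesis using ab D0[of a] D0[of b] 
          by (intro exI[of _ a] exI[of _ b]) (auto simp: less_le)
      qed
      then obtain u v where uv: "u \<in> V" "v \<in> V" "u \<noteq> v" "{u, v} \<notin> E"
        "D u = 0 \<or> D v > 0 \<and> \<phi> u * D v \<le> \<phi> v * D u" by blast
      obtain y where y: "\<And>v. v \<in> V - {u} \<Longrightarrow> y v \<ge> 0"
        "clique_weight E (V - {u}) y 2 = clique_weight E V x 2"
        "clique_weight E V x s - \<mu> * clique_weight E V x q
          \<le> clique_weight E (V - {u}) y s - \<mu> * clique_weight E (V - {u}) y q"
        by (rule symmetrization_step[of V v u E x s q \<mu>])
           (use uv assms psubset in \<open>auto simp: D_def \<phi>_def\<close>)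
      have "V - {u} \<subset> V" using uv by auto
      from psubset.IH[OF this, of y] y(1) obtain K z where
        "K \<subseteq> V - {u}" "nsets K 2 \<subseteq> E" "\<forall>v\<in>K. z v \<ge> 0"
        "esym K z 2 = clique_weight E (V - {u}) y 2"
        "clique_weight E (V - {u}) y s - \<mu> * clique_weight E (V - {u}) y q
          \<le> esym K z s - \<mu> * esym K z q" by blast
      then show ?thesis
        using y(2,3) by (intro exI[of _ K] exI[of _ z]) auto
    qed
  qed
  then show ?thesis using that by blast
qed

section \<open>Cliques with small weight of order \<open>r + 1\<close>\<close>

text \<open>Double counting of the pairs \<open>(T, v)\<close> with \<open>v \<in> T\<close> and
  \<open>T = insert v S\<close>.\<close>

lemma sum_nsets_insert:
  fixes f :: "'a set \<Rightarrow> real"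
  assumes "finite X"
  shows "(\<Sum>S\<in>nsets X k. \<Sum>v\<in>X - S. f (insert v S)) = (\<Sum>T\<in>nsets X (Suc k). \<Sum>v\<in>T. f T)"
proof -
  have "(\<Sum>S\<in>nsets X k. \<Sum>v\<in>X - S. f (insert v S))
      = (\<Sum>(S, v)\<in>Sigma (nsets X k) (\<lambda>S. X - S). f (insert v S))"
    by (rule sum.Sigma) (use assms in \<open>auto simp: finite_imp_finite_nsets\<close>)
  also have "\<dots> = (\<Sum>(T, v)\<in>Sigma (nsets X (Suc k)) (\<lambda>T. T). f T)"
    by (rule sum.reindex_bij_witness[where j = "\<lambda>(S, v). (insert v S, v)" and i = "\<lambda>(T, v). (T - {v}, v)"])
       (auto simp: nsets_def insert_absorb)
  also have "\<dots> = (\<Sum>T\<in>nsets X (Suc k). \<Sum>v\<in>T. f T)"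
    by (rule sum.Sigma[symmetric]) (use assms in \<open>auto simp: finite_imp_finite_nsets nsets_def\<close>)
  finally show ?thesis .
qed

lemma esym_Suc_sum:
  assumes "finite X"
  shows "real (Suc k) * esym X x (Suc k) = (\<Sum>S\<in>nsets X k. (\<Prod>v\<in>S. x v) * (\<Sum>v\<in>X - S. x v))"
proof -
  have "real (Suc k) * esym X x (Suc k) = (\<Sum>T\<in>nsets X (Suc k). \<Sum>v\<in>T. \<Prod>v\<in>T. x v)"
    unfolding esym_def sum_distrib_left by (rule sum.cong) (auto simp: nsets_def)
  also have "\<dots> = (\<Sum>S\<in>nsets X k. \<Sum>v\<in>X - S. \<Prod>v\<in>insert v S. x v)"
    by (rule sum_nsets_insert[OF assms, symmetric])
  also have "\<dots> = (\<Sum>S\<in>nsets X k. (\<Prod>v\<in>S. x v) * (\<Sum>v\<in>X - S. x v))"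
    unfolding sum_distrib_left
    by (intro sum.cong refl) (auto simp: nsets_def)
  finally show ?thesis .
qed

lemma esym_mono:
  assumes "finite Y" "X \<subseteq> Y" "\<And>v. v \<in> Y \<Longrightarrow> x v \<ge> 0"
  shows "esym X x k \<le> esym Y x k"
  unfolding esym_def
  by (rule sum_mono2) (use assms in \<open>auto simp: finite_imp_finite_nsets nsets_def intro!: prod_nonneg\<close>)

text \<open>The vertices of \<open>K - A\<close> are added one at a time; a new vertex
  \<open>b\<close> contributes \<open>x b\<close> times a polynomial of index \<open>k\<close> over
  a subset of \<open>K\<close>.\<close>

lemma esym_le_subset:
  assumes "finite K" "A \<subseteq> K" "\<And>v. v \<in> K \<Longrightarrow> x v \<ge> 0"
  shows "esym K x (Suc k) \<le> esym A x (Suc k) + (\<Sum>v\<in>K - A. x v) * esym K x k"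
proof -
  have "esym (A \<union> B) x (Suc k) \<le> esym A x (Suc k) + (\<Sum>v\<in>B. x v) * esym K x k" if "B \<subseteq> K - A" for B
    using finite_subset[OF that finite_Diff[OF assms(1)]] that
  proof (induction B rule: finite_induct)
    case (insert b B)
    have fin: "finite (A \<union> B)" using assms insert.hyps by (auto intro: finite_subset)
    have "esym (A \<union> insert b B) x (Suc k) = esym (A \<union> B) x (Suc k) + x b * esym (A \<union> B) x k"
      using esym_insert_Suc[OF fin, of b x k] insert by auto
    also have "\<dots> \<le> (esym A x (Suc k) + (\<Sum>v\<in>B. x v) * esym K x k) + x b * esym K x k"
      using insert assms by (intro add_mono mult_left_mono esym_mono) auto
    finally show ?case using insert by (simp add: algebra_simps)
  qed simp
  from this[of "K - A"] assms(2) show ?thesis by (simp add: Un_absorb1)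
qed

text \<open>Take \<open>A\<close> to be an \<open>r\<close>-subset of maximal weight. Then the complement of any set of at most \<open>r\<close>
  elements weighs at least as much as the complement of \<open>A\<close>, so a product over \<open>r + 1\<close>
  elements can be built greedily.\<close>

lemma heavy_subset:
  assumes "finite K" "\<And>v. v \<in> K \<Longrightarrow> x v \<ge> 0"
  obtains A where "A \<subseteq> K" "card A \<le> r"
    "(\<Sum>v\<in>K - A. x v) ^ Suc r \<le> fact (Suc r) * esym K x (Suc r)"
proof (cases "card K \<le> r")
  case True
  then show ?thesis by (intro that[of K]) (use esym_nonneg[of K x "Suc r", OF assms(2)] in simp_all)
next
  case False
  define w where "w S = (\<Sum>v\<in>S. x v)" for S
  have "finite (w ` nsets K r)" "w ` nsets K r \<noteq> {}"
    using assms(1) False by (auto simp: finite_imp_finite_nsets nsets_eq_empty_iff)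
  then have "Max (w ` nsets K r) \<in> w ` nsets K r" by (rule Max_in)
  then obtain A where A: "A \<in> nsets K r" "w A = Max (w ` nsets K r)" by auto
  \<comment> \<open>Sizes below \<open>r\<close> are included because the greedy product passes
    through them; a smaller set extends to size \<open>r\<close> without losing weight.\<close>
  have max: "w S \<le> w A" if S: "S \<in> nsets K k" "k \<le> r" for S k
  proof -
    obtain T where T: "S \<subseteq> T" "T \<subseteq> K" "card T = r"
      using exists_subset_between[of S r K] S assms(1) False by (auto simp: nsets_def)
    then have "finite T" using assms(1) finite_subset by blast
    then have "w S \<le> w T" unfolding w_def using T assms by (intro sum_mono2) auto
    also have "\<dots> \<le> w A" unfolding A(2)
      by (rule Max_ge) (use T \<open>finite T\<close> assms(1) in \<open>auto simp: nsets_def finite_imp_finite_nsets\<close>)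
    finally show ?thesis .
  qed
  define \<tau> where "\<tau> = (\<Sum>v\<in>K - A. x v)"
  have compl: "(\<Sum>v\<in>K - S. x v) = w K - w S" if "S \<subseteq> K" for S
    unfolding w_def by (rule sum_diff) (use assms that in auto)
  have \<tau>: "\<tau> = w K - w A" unfolding \<tau>_def by (rule compl) (use A in \<open>auto simp: nsets_def\<close>)
  have "\<tau> \<ge> 0" unfolding \<tau>_def by (rule sum_nonneg) (use assms in auto)
  have "\<tau> ^ k \<le> fact k * esym K x k" if "k \<le> Suc r" for k
    using that
  proof (induction k)
    case (Suc k)
    have "esym K x k * \<tau> \<le> (\<Sum>S\<in>nsets K k. (\<Prod>v\<in>S. x v) * (\<Sum>v\<in>K - S. x v))"
      unfolding esym_def sum_distrib_right
    proof (intro sum_mono mult_left_mono prod_nonneg)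
      fix S assume S: "S \<in> nsets K k"
      then show "\<tau> \<le> (\<Sum>v\<in>K - S. x v)"
        using max[OF S] Suc.prems by (subst compl) (auto simp: nsets_def \<tau>)
    qed (use assms in \<open>auto simp: nsets_def\<close>)
    also have "\<dots> = real (Suc k) * esym K x (Suc k)"
      by (rule esym_Suc_sum[symmetric]) fact
    finally have le: "esym K x k * \<tau> \<le> real (Suc k) * esym K x (Suc k)" .
    have "\<tau> ^ Suc k \<le> (fact k * esym K x k) * \<tau>"
      using Suc \<open>\<tau> \<ge> 0\<close> mult_right_mono[of "\<tau> ^ k" "fact k * esym K x k" \<tau>] by (simp add: mult_ac)
    also have "\<dots> = fact k * (esym K x k * \<tau>)" by simp
    also have "\<dots> \<le> fact k * (real (Suc k) * esym K x (Suc k))"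
      by (rule mult_left_mono[OF le]) simp
    finally show ?case by (simp only: fact_Suc mult_ac)
  qed simp
  from this[OF order_refl] show ?thesis
    unfolding \<tau>_def by (rule that[rotated 2]) (use A in \<open>auto simp: nsets_def\<close>)
qed

text \<open>A complete \<open>r\<close>-partite graph with parts of size \<open>a > 0\<close> has
  \<open>(r choose 2) * a ^ 2\<close> edges and \<open>(r choose s) * a ^ s\<close> cliques of order
  \<open>s\<close>. This is the second number divided by the first to the power
  \<open>s / 2\<close>.\<close>

definition turan_const :: "nat \<Rightarrow> nat \<Rightarrow> real" where
  "turan_const r s = real (r choose s) / sqrt (real (r choose 2)) ^ s"

text \<open>Let \<open>\<tau>\<close> be the weight outside a heavy set \<open>A\<close> of at most
  \<open>r\<close> vertices. If \<open>\<tau> \<le> \<epsilon> * M\<close>, the sharp Maclaurin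
  bound applies on \<open>A\<close> and the outside contributes little. Otherwise
  \<open>\<tau> ^ Suc r\<close> forces \<open>esym K x (Suc r)\<close> to be so large that the last
  term alone reaches the crude bound.\<close>

lemma esym_bound:
  assumes K: "finite K" "\<And>v. v \<in> K \<Longrightarrow> x v \<ge> 0" and "esym K x 2 = M^2"
    and "M > 0" "\<epsilon> > 0" "r \<ge> 2" "s \<ge> 3"
  shows "esym K x s \<le> (turan_const r s + 2 ^ s * \<epsilon>) * M ^ s
    + 2 ^ s * M ^ s * fact (Suc r) / (\<epsilon> * M) ^ Suc r * esym K x (Suc r)"
proof -
  obtain A where A: "A \<subseteq> K" "card A \<le> r"
    "(\<Sum>v\<in>K - A. x v) ^ Suc r \<le> fact (Suc r) * esym K x (Suc r)"
    by (rule heavy_subset[where K = K and x = x and r = r, OF K])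
  define \<tau> where "\<tau> = (\<Sum>v\<in>K - A. x v)"
  have crude: "esym K x k \<le> 2 ^ k * M ^ k" if "k \<ge> 2" for k
    using maclaurin_esym_crude[where x = x, OF K that] assms by simp
  have e0: "esym K x (Suc r) \<ge> 0" by (rule esym_nonneg) (use K in auto)
  have c0: "turan_const r s \<ge> 0" by (simp add: turan_const_def)
  show ?thesis
  proof (cases "\<tau> \<le> \<epsilon> * M")
    case True
    \<comment> \<open>The contribution of the outside involves \<open>esym\<close> at index
      \<open>s - 1\<close>, and the crude bound starts at index 2; hence
      \<open>s \<ge> 3\<close>.\<close>
    obtain k where k: "s = Suc k" "k \<ge> 2" using \<open>s \<ge> 3\<close> by (cases s) auto
    have "esym K x s \<le> esym A x s + \<tau> * esym K x k"
      unfolding k \<tau>_def by (rule esym_le_subset) (use K A in auto)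
    also have "esym A x s \<le> real (r choose s) * sqrt (esym A x 2 / real (r choose 2)) ^ s"
      by (rule maclaurin_esym) (use K A assms in \<open>auto intro: finite_subset\<close>)
    also have "\<dots> \<le> real (r choose s) * sqrt (M^2 / real (r choose 2)) ^ s"
      unfolding \<open>esym K x 2 = M^2\<close>[symmetric]
      by (intro mult_left_mono power_mono real_sqrt_le_mono divide_right_mono esym_mono)
         (use K A in \<open>auto intro!: divide_nonneg_nonneg esym_nonneg\<close>)
    also have "\<dots> = turan_const r s * M ^ s"
      using \<open>M > 0\<close> by (simp add: turan_const_def real_sqrt_divide power_divide)
    also have "\<tau> * esym K x k \<le> (\<epsilon> * M) * (2 ^ k * M ^ k)"
      by (intro mult_mono True crude k esym_nonneg) (use assms in auto)
    also have "\<dots> = 2 ^ k * \<epsilon> * M ^ s" by (simp add: k)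
    also have "\<dots> \<le> 2 ^ s * \<epsilon> * M ^ s" using assms by (simp add: k)
    finally have "esym K x s \<le> (turan_const r s + 2 ^ s * \<epsilon>) * M ^ s" by (simp add: algebra_simps)
    moreover have "0 \<le> 2 ^ s * M ^ s * fact (Suc r) / (\<epsilon> * M) ^ Suc r * esym K x (Suc r)"
      using assms e0 by (intro mult_nonneg_nonneg divide_nonneg_nonneg) auto
    ultimately show ?thesis by linarith
  next
    case False
    have "(\<epsilon> * M) ^ Suc r \<le> \<tau> ^ Suc r" using False assms by (intro power_mono) auto
    also have "\<dots> \<le> fact (Suc r) * esym K x (Suc r)" using A by (simp add: \<tau>_def)
    finally have "1 \<le> fact (Suc r) * esym K x (Suc r) / (\<epsilon> * M) ^ Suc r"
      using assms by simp
    then have "2 ^ s * M ^ s * 1 \<le> 2 ^ s * M ^ s * (fact (Suc r) * esym K x (Suc r) / (\<epsilon> * M) ^ Suc r)"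
      using assms by (intro mult_left_mono) auto
    moreover have "esym K x s \<le> 2 ^ s * M ^ s * 1" using crude[of s] assms by simp
    moreover have "0 \<le> (turan_const r s + 2 ^ s * \<epsilon>) * M ^ s" using c0 assms by simp
    ultimately show ?thesis by simp
  qed
qed

text \<open>\<open>esym_bound\<close> bounds the weight of order \<open>s\<close> minus
  \<open>\<mu>\<close> times that of order \<open>r + 1\<close>. Symmetrization preserves the edge
  weight and does not decrease this difference, so the bound passes from the final clique back to
  the whole graph.\<close>

lemma clique_weight_bound:
  fixes E :: "'a set set"
  assumes V: "finite V" "\<And>v. v \<in> V \<Longrightarrow> x v \<ge> 0" and "clique_weight E V x 2 = M^2"
    and "M > 0" "\<epsilon> > 0" "r \<ge> 2" "s \<ge> 3"
  shows "clique_weight E V x s \<le> (turan_const r s + 2 ^ s * \<epsilon>) * M ^ s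
    + 2 ^ s * M ^ s * fact (Suc r) / (\<epsilon> * M) ^ Suc r * clique_weight E V x (Suc r)"
proof -
  define \<mu> where "\<mu> = 2 ^ s * M ^ s * fact (Suc r) / (\<epsilon> * M) ^ Suc r"
  obtain K y where K: "K \<subseteq> V" "\<And>v. v \<in> K \<Longrightarrow> y v \<ge> 0" "esym K y 2 = clique_weight E V x 2"
    "clique_weight E V x s - \<mu> * clique_weight E V x (Suc r) \<le> esym K y s - \<mu> * esym K y (Suc r)"
    by (rule symmetrization[where V = V and x = x and s = s and q = "Suc r" and E = E and \<mu> = \<mu>, OF V]) (use assms in auto)
  have "esym K y s \<le> (turan_const r s + 2 ^ s * \<epsilon>) * M ^ s + \<mu> * esym K y (Suc r)"
    unfolding \<mu>_def by (rule esym_bound) (use K assms in \<open>auto intro: finite_subset\<close>)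
  then show ?thesis using K(4) unfolding \<mu>_def by linarith
qed

section \<open>Boxes in dense sets of tuples\<close>

lemma card_nsets:
  "finite A \<Longrightarrow> card (nsets A k) = card A choose k"
  using n_subsets[of A k] unfolding nsets_def
  by (metis (no_types, lifting) Collect_cong finite_subset)

lemma card_nsets_le:
  assumes "finite A"
  shows "card (nsets A k) \<le> card A ^ k"
proof -
  have "card (nsets A k) \<le> (card A choose k) * fact k" using assms by (simp add: card_nsets)
  also have "\<dots> \<le> card A ^ k" by (rule binomial_fact_pow)
  finally show ?thesis .
qed

lemma sum_card_Collect_swap:
  assumes "finite A" "finite B"
  shows "(\<Sum>a\<in>A. card {b \<in> B. P a b}) = (\<Sum>b\<in>B. card {a \<in> A. P a b})"
proof -
  have "(\<Sum>a\<in>A. card {b \<in> B. P a b}) = (\<Sum>a\<in>A. \<Sum>b\<in>B. of_bool (P a b))"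
    using assms(2) by (simp add: Int_def)
  also have "\<dots> = (\<Sum>b\<in>B. \<Sum>a\<in>A. of_bool (P a b))" by (rule sum.swap)
  also have "\<dots> = (\<Sum>b\<in>B. card {a \<in> A. P a b})"
    using assms(1) by (simp add: Int_def)
  finally show ?thesis .
qed

text \<open>Erdos' theorem on complete multipartite subhypergraphs. In the step, pairs of a tail \<open>l\<close> and a
  \<open>t\<close>-set of heads extending it are double counted.\<close>

lemma box_in_dense_set:
  fixes \<delta> :: real
  assumes "t \<ge> 1" "\<delta> > 0"
  shows "\<exists>n0. \<forall>(U::'a set) R. finite U \<longrightarrow> n0 \<le> card U \<longrightarrow> R \<subseteq> {l. set l \<subseteq> U \<and> length l = k} \<longrightarrow>
    \<delta> * real (card U) ^ k \<le> real (card R) \<longrightarrow>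
    (\<exists>As. length As = k \<and> (\<forall>A\<in>set As. A \<in> nsets U t) \<and> (\<forall>l. list_all2 (\<in>) l As \<longrightarrow> l \<in> R))"
  using assms(2)
proof (induction k arbitrary: \<delta>)
  case 0
  have "[] \<in> R" if "R \<subseteq> {l. set l \<subseteq> U \<and> length l = 0}" "\<delta> * real (card U) ^ 0 \<le> real (card R)"
    for U :: "'a set" and R
  proof (rule ccontr)
    assume "[] \<notin> R"
    with that have "R = {}" by auto
    with that 0 show False by simp
  qed
  then show ?case by auto
next
  case (Suc k)
  \<comment> \<open>The factor \<open>\<delta> / 2\<close> is the share of tails with many heads.
    The other is the share of \<open>t\<close>-sets among those heads relative to
    \<open>n ^ t\<close>, from the bound \<open>(h / t) ^ t\<close> for
    \<open>h choose t\<close>.\<close>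
  define \<delta>' where "\<delta>' = \<delta> / 2 * (\<delta> / (2 * real t)) ^ t"
  have "\<delta>' > 0" using Suc.prems assms(1) by (simp add: \<delta>'_def)
  then obtain n1 where n1: "\<And>(U::'a set) R. finite U \<Longrightarrow> n1 \<le> card U \<Longrightarrow>
    R \<subseteq> {l. set l \<subseteq> U \<and> length l = k} \<Longrightarrow> \<delta>' * real (card U) ^ k \<le> real (card R) \<Longrightarrow>
    \<exists>As. length As = k \<and> (\<forall>A\<in>set As. A \<in> nsets U t) \<and> (\<forall>l. list_all2 (\<in>) l As \<longrightarrow> l \<in> R)"
    using Suc.IH by blast
  \<comment> \<open>The last bound makes \<open>\<delta> * n / 2\<close> at least \<open>t\<close>,
    so that the binomial estimate applies; the 1 excludes an empty ground set.\<close>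
  define n0 where "n0 = max n1 (max 1 (nat \<lceil>2 * real t / \<delta>\<rceil>))"
  have "\<exists>As. length As = Suc k \<and> (\<forall>A\<in>set As. A \<in> nsets U t) \<and> (\<forall>l. list_all2 (\<in>) l As \<longrightarrow> l \<in> R)"
    if U: "finite U" "n0 \<le> card U" and R: "R \<subseteq> {l. set l \<subseteq> U \<and> length l = Suc k}"
      "\<delta> * real (card U) ^ Suc k \<le> real (card R)" for U :: "'a set" and R
  proof -
    define n where "n = real (card U)"
    have "n > 0" using U by (simp add: n_def n0_def)
    have "2 * real t / \<delta> \<le> real (nat \<lceil>2 * real t / \<delta>\<rceil>)" by (rule real_nat_ceiling_ge)
    also have "\<dots> \<le> n" using U unfolding n_def n0_def by simp
    finally have nt: "real t \<le> \<delta> * n / 2" using Suc.prems by (simp add: field_simps)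
    define L where "L = {l. set l \<subseteq> U \<and> length l = k}"
    have L: "finite L" "real (card L) = n ^ k"
      unfolding L_def n_def using U by (simp_all add: finite_lists_length_eq card_lists_length_eq)
    define N where "N l = {v \<in> U. v # l \<in> R}" for l
    have N: "finite (N l)" "card (N l) \<le> card U" for l
      unfolding N_def using U by (auto intro: card_mono)
    have "R = (\<lambda>(l, v). v # l) ` Sigma L N"
    proof (intro equalityI subsetI)
      fix l assume l: "l \<in> R"
      with R(1) have "length l = Suc k" "set l \<subseteq> U" by auto
      then obtain v l' where "l = v # l'" "l' \<in> L" "v \<in> U" by (cases l) (auto simp: L_def)
      then show "l \<in> (\<lambda>(l, v). v # l) ` Sigma L N" using l by (force simp: N_def)
    qed (auto simp: N_def)
    then have "card R = card ((\<lambda>(l, v). v # l) ` Sigma L N)" by simp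
    also have "\<dots> = card (Sigma L N)" by (rule card_image) (auto simp: inj_on_def)
    also have "\<dots> = (\<Sum>l\<in>L. card (N l))" using L N by (simp add: card_SigmaI)
    finally have cardR: "card R = (\<Sum>l\<in>L. card (N l))" .
    \<comment> \<open>Tails with few heads account for at most
      \<open>\<delta> / 2 * n ^ Suc k\<close> tuples, so at least
      \<open>\<delta> / 2 * n ^ k\<close> tails have many.\<close>
    define G where "G = {l \<in> L. \<delta> * n / 2 \<le> real (card (N l))}"
    have G: "finite G" "G \<subseteq> L" using L by (auto simp: G_def)
    have "real (card R) \<le> (\<Sum>l\<in>L. of_bool (l \<in> G) * n + \<delta> * n / 2)"
      unfolding cardR of_nat_sum
    proof (rule sum_mono)
      fix l assume "l \<in> L"
      show "real (card (N l)) \<le> of_bool (l \<in> G) * n + \<delta> * n / 2"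
      proof (cases "l \<in> G")
        case True
        have "0 \<le> \<delta> * n / 2" using Suc.prems \<open>n > 0\<close> by simp
        moreover have "real (card (N l)) \<le> n" using N(2)[of l] by (simp add: n_def)
        ultimately show ?thesis using True by simp
      qed (use \<open>l \<in> L\<close> in \<open>simp add: G_def\<close>)
    qed
    also have "\<dots> = real (card G) * n + n ^ k * (\<delta> * n / 2)"
      using L G by (simp add: sum.distrib sum_distrib_right[symmetric] Int_absorb1 flip: L(2))
    finally have "\<delta> * n ^ Suc k \<le> real (card G) * n + n ^ k * (\<delta> * n / 2)"
      using R(2) by (simp add: n_def)
    then have "(\<delta> / 2 * n ^ k) * n \<le> real (card G) * n" by (simp add: algebra_simps)
    then have cardG: "\<delta> / 2 * n ^ k \<le> real (card G)" using \<open>n > 0\<close> by (simp only: mult_le_cancel_right_pos)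
    define W where "W T = {l \<in> L. T \<subseteq> N l}" for T
    have "\<delta>' * n ^ k * n ^ t = (\<delta> / 2 * n ^ k) * ((\<delta> * n / 2) / real t) ^ t"
      by (simp add: \<delta>'_def power_mult_distrib power_divide)
    also have "\<dots> \<le> real (card G) * ((\<delta> * n / 2) / real t) ^ t"
      by (rule mult_right_mono[OF cardG]) (use \<open>n > 0\<close> Suc.prems in auto)
    also have "\<dots> = (\<Sum>l\<in>G. ((\<delta> * n / 2) / real t) ^ t)" by simp
    also have "\<dots> \<le> (\<Sum>l\<in>G. real (card (nsets (N l) t)))"
    proof (rule sum_mono)
      fix l assume l: "l \<in> G"
      have "((\<delta> * n / 2) / real t) ^ t \<le> (real (card (N l)) / real t) ^ t"
        using l \<open>n > 0\<close> Suc.prems by (intro power_mono divide_right_mono) (auto simp: G_def)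
      also have "\<dots> \<le> real (card (N l) choose t)"
        by (rule binomial_ge_n_over_k_pow_k) (use l nt in \<open>auto simp: G_def\<close>)
      also have "\<dots> = real (card (nsets (N l) t))" using N by (simp add: card_nsets)
      finally show "((\<delta> * n / 2) / real t) ^ t \<le> real (card (nsets (N l) t))" .
    qed
    also have "\<dots> \<le> (\<Sum>l\<in>L. real (card (nsets (N l) t)))"
      using L G by (intro sum_mono2) auto
    also have "\<dots> = real (\<Sum>l\<in>L. card {T \<in> nsets U t. T \<subseteq> N l})"
      unfolding of_nat_sum
      by (intro sum.cong refl arg_cong[where f = real] arg_cong[where f = card])
         (auto simp: nsets_def N_def)
    also have "\<dots> = (\<Sum>T\<in>nsets U t. real (card (W T)))"
      using L U by (subst sum_card_Collect_swap) (auto simp: finite_imp_finite_nsets W_def)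
    finally have sumW: "\<delta>' * n ^ k * n ^ t \<le> (\<Sum>T\<in>nsets U t. real (card (W T)))" .
    \<comment> \<open>Averaging over at most \<open>n ^ t\<close> sets \<open>T\<close>. The
      induction hypothesis for \<open>W T\<close> then yields the remaining blocks.\<close>
    have "\<exists>T\<in>nsets U t. \<delta>' * n ^ k \<le> real (card (W T))"
    proof (rule ccontr)
      assume "\<not> ?thesis"
      then have *: "real (card (W T)) < \<delta>' * n ^ k" if "T \<in> nsets U t" for T using that by force
      show False
      proof (cases "nsets U t = {}")
        case True
        have "0 < \<delta>' * n ^ k * n ^ t" using \<open>\<delta>' > 0\<close> \<open>n > 0\<close> by simp
        with sumW True show False by simp
      next
        case False
        have "(\<Sum>T\<in>nsets U t. real (card (W T))) < (\<Sum>T\<in>nsets U t. \<delta>' * n ^ k)"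
          using U False by (intro sum_strict_mono *) (auto simp: finite_imp_finite_nsets)
        also have "\<dots> = real (card (nsets U t)) * (\<delta>' * n ^ k)" by simp
        also have "\<dots> \<le> n ^ t * (\<delta>' * n ^ k)"
        proof (rule mult_right_mono)
          show "real (card (nsets U t)) \<le> n ^ t"
            unfolding n_def of_nat_power[symmetric] of_nat_le_iff by (rule card_nsets_le) fact
        qed (use \<open>\<delta>' > 0\<close> \<open>n > 0\<close> in auto)
        finally show False using sumW by (simp add: mult_ac)
      qed
    qed
    then obtain T where T: "T \<in> nsets U t" "\<delta>' * n ^ k \<le> real (card (W T))" by blast
    have "n1 \<le> card U" using U by (simp add: n0_def)
    moreover have "W T \<subseteq> {l. set l \<subseteq> U \<and> length l = k}" by (auto simp: W_def L_def)
    ultimately obtain As where As: "length As = k" "\<forall>A\<in>set As. A \<in> nsets U t"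
        "\<forall>l. list_all2 (\<in>) l As \<longrightarrow> l \<in> W T"
      using n1[OF U(1), of "W T"] T(2) unfolding n_def by blast
    have "l \<in> R" if l: "list_all2 (\<in>) l (T # As)" for l
    proof -
      obtain v l' where "l = v # l'" "v \<in> T" "list_all2 (\<in>) l' As"
        using l by (auto simp: list_all2_Cons2)
      then show ?thesis using As(3) by (auto simp: W_def N_def)
    qed
    then show ?thesis using As T by (intro exI[of _ "T # As"]) auto
  qed
  then show ?case by blast
qed

section \<open>Graphs without a given subgraph\<close>

text \<open>Cliques of order \<open>q\<close> are read as tuples. A box of such tuples consists of
  \<open>q\<close> disjoint, completely joined blocks, each larger than \<open>F\<close>, and colour
  class \<open>i\<close> of \<open>F\<close> is placed in block \<open>i\<close>.\<close>

lemma embedding_in_dense_graph: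
  fixes F :: "'a sgraph" and \<delta> :: real
  assumes F: "finite_simple_graph F" "proper_coloring F q c" and "\<delta> > 0"
  shows "\<exists>n0. \<forall>(U::nat set) E. finite U \<longrightarrow> n0 \<le> card U \<longrightarrow>
    \<delta> * real (card U) ^ q \<le> real (card (cliques E U q)) \<longrightarrow>
    (\<exists>f. inj_on f (verts F) \<and> f ` verts F \<subseteq> U \<and> (\<forall>e\<in>edges F. f ` e \<in> E))"
proof -
  \<comment> \<open>\<open>Suc\<close> keeps the blocks nonempty even if \<open>F\<close> has no
    vertices.\<close>
  define t where "t = Suc (card (verts F))"
  have "t \<ge> 1" by (simp add: t_def)
  obtain n0 where n0: "\<And>(U::nat set) R. finite U \<Longrightarrow> n0 \<le> card U \<Longrightarrow>
    R \<subseteq> {l. set l \<subseteq> U \<and> length l = q} \<Longrightarrow> \<delta> * real (card U) ^ q \<le> real (card R) \<Longrightarrow>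
    \<exists>As. length As = q \<and> (\<forall>A\<in>set As. A \<in> nsets U t) \<and> (\<forall>l. list_all2 (\<in>) l As \<longrightarrow> l \<in> R)"
    using box_in_dense_set[OF \<open>t \<ge> 1\<close> assms(3), of q] by blast
  have "\<exists>f. inj_on f (verts F) \<and> f ` verts F \<subseteq> U \<and> (\<forall>e\<in>edges F. f ` e \<in> E)"
    if U: "finite U" "n0 \<le> card U" and dense: "\<delta> * real (card U) ^ q \<le> real (card (cliques E U q))"
    for U :: "nat set" and E
  proof -
    \<comment> \<open>Sorting fixes one tuple per clique, so there are as many tuples as
      cliques.\<close>
    define R where "R = sorted_list_of_set ` cliques E U q"
    have "inj_on sorted_list_of_set (cliques E U q)"
      by (rule inj_onI) (auto simp: in_cliques_iff sorted_list_of_set_inject)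
    then have "card R = card (cliques E U q)" by (simp add: R_def card_image)
    moreover have "R \<subseteq> {l. set l \<subseteq> U \<and> length l = q}"
      unfolding R_def by (auto simp: in_cliques_iff)
    ultimately obtain As where As: "length As = q" "\<forall>A\<in>set As. A \<in> nsets U t"
        "\<And>l. list_all2 (\<in>) l As \<Longrightarrow> l \<in> R"
      using n0[of U R] U dense by auto
    have nth: "As ! i \<subseteq> U" "finite (As ! i)" "card (As ! i) = t" if "i < q" for i
      using As(1,2) that nth_mem[of i As] by (auto simp: nsets_def)
    have ne: "\<exists>w. w \<in> As ! i" if "i < q" for i
    proof -
      have "As ! i \<noteq> {}" using nth(3)[OF that] by (auto simp: t_def)
      then show ?thesis by blast
    qed
    \<comment> \<open>Complete \<open>x\<close> and \<open>y\<close> to a tuple of the box by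
      arbitrary choices elsewhere. It enumerates a clique without repetition, which gives adjacency
      and the disjointness of the blocks.\<close>
    have adj: "{x, y} \<in> E \<and> x \<noteq> y"
      if ij: "i < q" "j < q" "i \<noteq> j" and xy: "x \<in> As ! i" "y \<in> As ! j" for i j x y
    proof -
      define l where "l = map (\<lambda>k. if k = i then x else if k = j then y else (SOME w. w \<in> As ! k)) [0..<q]"
      have "list_all2 (\<in>) l As"
        unfolding list_all2_conv_all_nth l_def using As(1) ij xy someI_ex[OF ne] by auto
      then have "l \<in> R" by (rule As(3))
      then have d: "distinct l" "nsets (set l) 2 \<subseteq> E"
        by (auto simp: R_def in_cliques_iff)
      have "l ! i = x" "l ! j = y" "i < length l" "j < length l" using ij by (auto simp: l_def)
      then have "x \<noteq> y" "x \<in> set l" "y \<in> set l"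
        using d(1) ij nth_eq_iff_index_eq[of l i j] nth_mem[of i l] nth_mem[of j l] by auto
      then have "{x, y} \<in> nsets (set l) 2" by simp
      with d(2) \<open>x \<noteq> y\<close> show ?thesis by blast
    qed
    have "\<exists>\<phi>. inj_on \<phi> (verts F) \<and> \<phi> ` verts F \<subseteq> As ! i" if "i < q" for i
      using card_le_inj[of "verts F" "As ! i"] F(1) nth[OF that]
      by (auto simp: finite_simple_graph_def t_def)
    then obtain \<phi> where \<phi>: "\<And>i. i < q \<Longrightarrow> inj_on (\<phi> i) (verts F)"
        "\<And>i. i < q \<Longrightarrow> \<phi> i ` verts F \<subseteq> As ! i"
      by metis
    define f where "f v = \<phi> (c v) v" for v
    have c: "c v < q" if "v \<in> verts F" for v using F(2) that by (auto simp: proper_coloring_def)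
    have fA: "f v \<in> As ! c v" if "v \<in> verts F" for v
      using \<phi>(2)[OF c[OF that]] that by (auto simp: f_def)
    have "inj_on f (verts F)"
    proof (rule inj_onI, rule ccontr)
      fix u v assume uv: "u \<in> verts F" "v \<in> verts F" "f u = f v" "u \<noteq> v"
      show False
      proof (cases "c u = c v")
        case True
        then have "\<phi> (c u) u = \<phi> (c u) v" using uv by (simp add: f_def)
        then show False using inj_onD[OF \<phi>(1)[OF c[OF uv(1)]]] uv by blast
      next
        case False
        then show False using adj[OF c[OF uv(1)] c[OF uv(2)] False fA fA] uv by simp
      qed
    qed
    moreover have "f ` verts F \<subseteq> U" using fA nth(1) c by blast
    moreover have "f ` e \<in> E" if "e \<in> edges F" for e
    proof -
      have "e \<in> nsets (verts F) 2" using F(1) that by (auto simp: finite_simple_graph_def)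
      then obtain u v where uv: "e = {u, v}" "u \<in> verts F" "v \<in> verts F" by (auto elim: nsets2_E)
      then have "c u \<noteq> c v" using F(2) that by (auto simp: proper_coloring_def)
      from adj[OF c[OF uv(2)] c[OF uv(3)] this fA fA] show ?thesis using uv by simp
    qed
    ultimately show ?thesis by blast
  qed
  then show ?thesis by blast
qed

section \<open>Counting cliques by vertex degrees\<close>

definition degree :: "'a set set \<Rightarrow> 'a \<Rightarrow> nat" where
  "degree E v = card {e \<in> E. v \<in> e}"

lemma sum_degree:
  assumes "finite V" "E \<subseteq> nsets V 2"
  shows "(\<Sum>v\<in>V. degree E v) = 2 * card E"
proof -
  have fin: "finite E" using assms finite_imp_finite_nsets finite_subset by blast
  have "(\<Sum>v\<in>V. degree E v) = (\<Sum>e\<in>E. card {v \<in> V. v \<in> e})"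
    unfolding degree_def by (rule sum_card_Collect_swap) fact+
  also have "\<dots> = (\<Sum>e\<in>E. 2)"
  proof (rule sum.cong[OF refl])
    fix e assume "e \<in> E"
    then have "e \<subseteq> V" "card e = 2" using assms by (auto simp: nsets_def)
    moreover then have "{v \<in> V. v \<in> e} = e" by blast
    ultimately show "card {v \<in> V. v \<in> e} = 2" by simp
  qed
  finally show ?thesis by simp
qed

text \<open>A clique through \<open>v\<close> is determined by its other \<open>k\<close> vertices,
  all of them neighbours of \<open>v\<close>.\<close>

lemma card_cliques_at_le:
  assumes "finite V" "E \<subseteq> nsets V 2"
  shows "card {S \<in> cliques E V (Suc k). v \<in> S} \<le> degree E v ^ k"
proof -
  define N where "N = {w \<in> V. {v, w} \<in> E \<and> w \<noteq> v}"
  have fin: "finite E" using assms finite_imp_finite_nsets finite_subset by blast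
  have "card N = card ((\<lambda>w. {v, w}) ` N)"
    by (rule card_image[symmetric]) (auto simp: inj_on_def N_def doubleton_eq_iff)
  also have "\<dots> \<le> degree E v" unfolding degree_def
    by (rule card_mono) (use fin in \<open>auto simp: N_def\<close>)
  finally have N: "card N \<le> degree E v" .
  have "inj_on (\<lambda>S. S - {v}) {S \<in> cliques E V (Suc k). v \<in> S}"
    by (rule inj_onI) (metis (mono_tags, lifting) insert_Diff mem_Collect_eq)
  then have "card {S \<in> cliques E V (Suc k). v \<in> S} =
      card ((\<lambda>S. S - {v}) ` {S \<in> cliques E V (Suc k). v \<in> S})"
    by (rule card_image[symmetric])
  also have "\<dots> \<le> card (nsets N k)"
  proof (rule card_mono)
    show "finite (nsets N k)" using assms by (simp add: N_def finite_imp_finite_nsets)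
    show "(\<lambda>S. S - {v}) ` {S \<in> cliques E V (Suc k). v \<in> S} \<subseteq> nsets N k"
    proof clarsimp
      fix S assume S: "S \<in> cliques E V (Suc k)" "v \<in> S"
      have "w \<in> N" if "w \<in> S" "w \<noteq> v" for w
      proof -
        have "{v, w} \<in> nsets S 2" using S that by simp
        then show ?thesis using S that unfolding N_def in_cliques_iff by blast
      qed
      then show "S - {v} \<in> nsets N k" using S by (auto simp: nsets_def in_cliques_iff)
    qed
  qed
  also have "\<dots> \<le> card N ^ k" by (rule card_nsets_le) (use assms in \<open>simp add: N_def\<close>)
  also have "\<dots> \<le> degree E v ^ k" by (rule power_mono[OF N]) simp
  finally show ?thesis .
qed

text \<open>A clique not inside \<open>U\<close> contains a vertex of degree below \<open>d\<close>.
  Of the \<open>k + 1\<close> degree factors from \<open>card_cliques_at_le\<close>,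
  \<open>k\<close> are bounded by \<open>d\<close> and the last is summed over all vertices.\<close>

lemma card_cliques_low_degree:
  fixes d :: real
  assumes V: "finite V" "E \<subseteq> nsets V 2" and "d \<ge> 0"
  defines "U \<equiv> {v \<in> V. real (degree E v) \<ge> d}"
  shows "real (card (cliques E V (k + 2))) \<le> real (card (cliques E U (k + 2))) + 2 * real (card E) * d ^ k"
proof -
  have "cliques E V (k + 2) \<subseteq> cliques E U (k + 2) \<union> (\<Union>v\<in>V - U. {S \<in> cliques E V (k + 2). v \<in> S})"
  proof
    fix S assume S: "S \<in> cliques E V (k + 2)"
    show "S \<in> cliques E U (k + 2) \<union> (\<Union>v\<in>V - U. {S \<in> cliques E V (k + 2). v \<in> S})"
    proof (cases "S \<subseteq> U")
      case True
      then show ?thesis using S by (simp add: in_cliques_iff)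
    next
      case False
      then show ?thesis using S by (auto simp: in_cliques_iff)
    qed
  qed
  then have "card (cliques E V (k + 2)) \<le>
      card (cliques E U (k + 2) \<union> (\<Union>v\<in>V - U. {S \<in> cliques E V (k + 2). v \<in> S}))"
    by (intro card_mono finite_UnI finite_UN_I finite_cliques) (use V in \<open>auto simp: U_def\<close>)
  also have "\<dots> \<le> card (cliques E U (k + 2)) + card (\<Union>v\<in>V - U. {S \<in> cliques E V (k + 2). v \<in> S})"
    by (rule card_Un_le)
  also have "card (\<Union>v\<in>V - U. {S \<in> cliques E V (k + 2). v \<in> S})
      \<le> (\<Sum>v\<in>V - U. card {S \<in> cliques E V (k + 2). v \<in> S})"
    by (rule card_UN_le) (use V in auto)
  also have "\<dots> \<le> (\<Sum>v\<in>V - U. degree E v ^ (k + 1))"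
    by (rule sum_mono) (use card_cliques_at_le[OF V, of "k + 1"] in simp)
  finally have "card (cliques E V (k + 2)) \<le> card (cliques E U (k + 2)) + (\<Sum>v\<in>V - U. degree E v ^ (k + 1))"
    by simp
  then have "real (card (cliques E V (k + 2))) \<le>
      real (card (cliques E U (k + 2)) + (\<Sum>v\<in>V - U. degree E v ^ (k + 1)))"
    by (simp only: of_nat_le_iff)
  also have "\<dots> = real (card (cliques E U (k + 2))) + (\<Sum>v\<in>V - U. real (degree E v) * real (degree E v) ^ k)"
    by simp
  also have "(\<Sum>v\<in>V - U. real (degree E v) * real (degree E v) ^ k) \<le> (\<Sum>v\<in>V - U. real (degree E v) * d ^ k)"
    by (intro sum_mono mult_left_mono power_mono) (auto simp: U_def)
  also have "\<dots> \<le> (\<Sum>v\<in>V. real (degree E v) * d ^ k)"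
    by (rule sum_mono2) (use assms in auto)
  also have "\<dots> = real (\<Sum>v\<in>V. degree E v) * d ^ k" by (simp add: sum_distrib_right)
  also have "\<dots> = 2 * real (card E) * d ^ k" unfolding sum_degree[OF V] by simp
  finally show ?thesis by simp
qed

text \<open>The degree threshold is \<open>\<eta> * M\<close>, with \<open>M\<close> the square root
  of the number of edges. At most \<open>2 * M / \<eta>\<close> vertices reach it, and too many
  cliques among these would embed \<open>F\<close>; all other cliques fall to
  \<open>card_cliques_low_degree\<close>.\<close>

lemma few_cliques:
  fixes F :: "'a sgraph" and \<epsilon> :: real
  assumes F: "finite_simple_graph F" "proper_coloring F (k + 2) c" and "\<epsilon> > 0" "k \<ge> 1"
  shows "\<exists>m0. \<forall>(V::nat set) E. finite V \<longrightarrow> E \<subseteq> nsets V 2 \<longrightarrow> m0 \<le> card E \<longrightarrow>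
    \<not> (\<exists>f. inj_on f (verts F) \<and> f ` verts F \<subseteq> V \<and> (\<forall>e\<in>edges F. f ` e \<in> E)) \<longrightarrow>
    real (card (cliques E V (k + 2))) \<le> \<epsilon> * sqrt (real (card E)) ^ (k + 2)"
proof -
  \<comment> \<open>Since \<open>\<eta> \<le> 1\<close> and \<open>k \<ge> 1\<close>, this gives
    \<open>2 * \<eta> ^ k \<le> \<epsilon> / 2\<close> for the low-degree part.\<close>
  define \<eta> where "\<eta> = min 1 (\<epsilon> / 4)"
  have \<eta>: "0 < \<eta>" "\<eta> \<le> 1" "4 * \<eta> \<le> \<epsilon>" using assms(3) by (auto simp: \<eta>_def)
  \<comment> \<open>Chosen so that \<open>\<delta> * (2 * M / \<eta>) ^ (k + 2)\<close> equals
    \<open>\<epsilon> / 2 * M ^ (k + 2)\<close>.\<close>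
  define \<delta> where "\<delta> = \<epsilon> / 2 * (\<eta> / 2) ^ (k + 2)"
  have "\<delta> > 0" using assms(3) \<eta> by (simp add: \<delta>_def)
  obtain n0 where n0: "\<And>(U::nat set) E. finite U \<Longrightarrow> n0 \<le> card U \<Longrightarrow>
    \<delta> * real (card U) ^ (k + 2) \<le> real (card (cliques E U (k + 2))) \<Longrightarrow>
    \<exists>f. inj_on f (verts F) \<and> f ` verts F \<subseteq> U \<and> (\<forall>e\<in>edges F. f ` e \<in> E)"
    using embedding_in_dense_graph[OF F \<open>\<delta> > 0\<close>] by blast
  \<comment> \<open>Covers the case that \<open>U\<close> has fewer than \<open>n0\<close> vertices:
    its at most \<open>n0 ^ (k + 2)\<close> cliques are absorbed once
    \<open>M \<ge> b\<close>.\<close>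
  define b where "b = 2 * real n0 ^ (k + 2) / \<epsilon>"
  define m0 where "m0 = Suc (nat \<lceil>b^2\<rceil>)"
  have "real (card (cliques E V (k + 2))) \<le> \<epsilon> * sqrt (real (card E)) ^ (k + 2)"
    if V: "finite V" "E \<subseteq> nsets V 2" and m: "m0 \<le> card E"
      and free: "\<not> (\<exists>f. inj_on f (verts F) \<and> f ` verts F \<subseteq> V \<and> (\<forall>e\<in>edges F. f ` e \<in> E))"
    for V :: "nat set" and E
  proof -
    define M where "M = sqrt (real (card E))"
    have M2: "real (card E) = M^2" by (simp add: M_def)
    have "1 \<le> card E" using m by (simp add: m0_def)
    then have "M \<ge> 1" by (simp add: M_def)
    have "b \<ge> 0" using assms(3) by (simp add: b_def)
    have "b^2 \<le> real (nat \<lceil>b^2\<rceil>)" by (rule real_nat_ceiling_ge)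
    also have "\<dots> \<le> M^2" using m unfolding M2[symmetric] m0_def by simp
    finally have "b \<le> M" by (rule power2_le_imp_le) (use \<open>M \<ge> 1\<close> in simp)
    define U where "U = {v \<in> V. real (degree E v) \<ge> \<eta> * M}"
    have U: "finite U" "U \<subseteq> V" using V by (auto simp: U_def)
    have "real (card U) * (\<eta> * M) = (\<Sum>v\<in>U. \<eta> * M)" by simp
    also have "\<dots> \<le> (\<Sum>v\<in>U. real (degree E v))" by (rule sum_mono) (simp add: U_def)
    also have "\<dots> \<le> (\<Sum>v\<in>V. real (degree E v))" by (rule sum_mono2) (use U V in auto)
    also have "\<dots> = 2 * M^2" 
      unfolding of_nat_sum[symmetric] sum_degree[OF V] by (simp add: M2)
    finally have "(real (card U) * \<eta>) * M \<le> (2 * M) * M"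
      by (simp only: power2_eq_square mult.assoc)
    then have "real (card U) * \<eta> \<le> 2 * M"
      using \<open>M \<ge> 1\<close> by (simp only: mult_le_cancel_right_pos)
    then have cardU: "real (card U) \<le> 2 * M / \<eta>"
      using \<eta>(1) by (simp only: pos_le_divide_eq)
    have cU: "real (card (cliques E U (k + 2))) \<le> \<epsilon> / 2 * M ^ (k + 2)"
    proof (cases "n0 \<le> card U")
      case True
      have "real (card (cliques E U (k + 2))) \<le> \<delta> * real (card U) ^ (k + 2)"
      proof (rule ccontr)
        assume "\<not> ?thesis"
        then have "\<delta> * real (card U) ^ (k + 2) \<le> real (card (cliques E U (k + 2)))" by (rule less_imp_le[OF not_le_imp_less])
        then obtain f where f: "inj_on f (verts F)" "f ` verts F \<subseteq> U" "\<forall>e\<in>edges F. f ` e \<in> E"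
          using n0[OF U(1) True] by metis
        have "f ` verts F \<subseteq> V" using f(2) U(2) by (rule order_trans)
        with f free show False by metis
      qed
      also have "\<dots> \<le> \<delta> * (2 * M / \<eta>) ^ (k + 2)"
        by (intro mult_left_mono power_mono cardU) (use \<open>\<delta> > 0\<close> in auto)
      also have "\<dots> = \<epsilon> / 2 * ((\<eta> / 2) * (2 * M / \<eta>)) ^ (k + 2)"
        unfolding \<delta>_def power_mult_distrib by simp
      also have "(\<eta> / 2) * (2 * M / \<eta>) = M" using \<eta> by simp
      finally show ?thesis .
    next
      case False
      have "card (cliques E U (k + 2)) \<le> card (nsets U (k + 2))"
        by (rule card_mono) (use U in \<open>auto simp: cliques_def finite_imp_finite_nsets\<close>)
      also have "\<dots> \<le> card U ^ (k + 2)" by (rule card_nsets_le) (rule U)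
      also have "\<dots> \<le> n0 ^ (k + 2)" by (rule power_mono) (use False in auto)
      finally have "real (card (cliques E U (k + 2))) \<le> real n0 ^ (k + 2)"
        unfolding of_nat_power[symmetric] of_nat_le_iff .
      also have "\<dots> = \<epsilon> / 2 * b" using assms(3) by (simp add: b_def)
      also have "\<dots> \<le> \<epsilon> / 2 * M ^ (k + 2)"
      proof (rule mult_left_mono)
        have "b \<le> M" by fact
        also have "\<dots> \<le> M ^ (k + 2)" by (rule self_le_power) (use \<open>M \<ge> 1\<close> in auto)
        finally show "b \<le> M ^ (k + 2)" .
      qed (use assms(3) in simp)
      finally show ?thesis .
    qed
    have "real (card (cliques E V (k + 2))) \<le> real (card (cliques E U (k + 2))) + 2 * real (card E) * (\<eta> * M) ^ k"
      unfolding U_def by (rule card_cliques_low_degree[OF V]) (use \<eta> \<open>M \<ge> 1\<close> in auto)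
    also have "2 * real (card E) * (\<eta> * M) ^ k = 2 * \<eta> ^ k * M ^ (k + 2)"
      unfolding M2 by (simp add: power_mult_distrib power_add power2_eq_square)
    also have "\<dots> \<le> \<epsilon> / 2 * M ^ (k + 2)"
    proof (rule mult_right_mono)
      have "\<eta> ^ k \<le> \<eta> ^ 1" by (rule power_decreasing) (use assms(4) \<eta> in auto)
      then show "2 * \<eta> ^ k \<le> \<epsilon> / 2" using \<eta> by simp
    qed (use \<open>M \<ge> 1\<close> in simp)
    finally show ?thesis using cU unfolding M_def by simp
  qed
  then show ?thesis by blast
qed

section \<open>Copies as cliques, and the upper bound on their number\<close>

lemma not_free_ofI:
  assumes F: "finite_simple_graph F" and f: "inj_on f (verts F)" "f ` verts F \<subseteq> verts G"
    "\<forall>e\<in>edges F. f ` e \<in> edges G"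
  shows "\<not> free_of F G"
proof -
  define H where "H = (f ` verts F, (`) f ` edges F)"
  have "f ` e \<in> nsets (f ` verts F) 2" if "e \<in> edges F" for e
  proof -
    have e: "e \<subseteq> verts F" "finite e" "card e = 2"
      using F that by (auto simp: finite_simple_graph_def nsets_def)
    then have "card (f ` e) = 2" using f(1) by (simp add: card_image inj_on_subset)
    then show ?thesis using e by (auto simp: nsets_def)
  qed
  then have "subgraph H G"
    using F f by (auto simp: subgraph_def H_def finite_simple_graph_def)
  moreover have "isomorphic F H"
    unfolding isomorphic_def H_def using f(1) by (intro exI[of _ f]) (auto simp: bij_betw_def)
  ultimately show ?thesis unfolding free_of_def by blast
qed

text \<open>A \<open>subgraph\<close> need not be induced, but a copy of a complete graph contains
  all pairs of its vertices and so is fixed by its vertex set.\<close>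

lemma copies_complete_graph:
  assumes G: "finite_simple_graph G"
  shows "copies (complete_graph s) G = (\<lambda>S. (S, nsets S 2)) ` cliques (edges G) (verts G) s"
proof (intro equalityI subsetI)
  fix H assume "H \<in> copies (complete_graph s) G"
  then obtain f where H: "subgraph H G" "bij_betw f {..<s} (verts H)"
      "(\<lambda>e. f ` e) ` nsets {..<s} 2 = edges H"
    by (auto simp: copies_def isomorphic_def complete_graph_def)
  have "edges H = nsets (verts H) 2"
    using bij_betw_nsets[OF H(2), of 2] H(3) by (simp add: bij_betw_def)
  moreover have "card (verts H) = s" "finite (verts H)"
    using bij_betw_same_card[OF H(2)] bij_betw_finite[OF H(2)] by auto
  ultimately have "H = (verts H, nsets (verts H) 2)" "verts H \<in> cliques (edges G) (verts G) s"
    using H(1) by (auto simp: in_cliques_iff subgraph_def prod_eq_iff)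
  then show "H \<in> (\<lambda>S. (S, nsets S 2)) ` cliques (edges G) (verts G) s" by blast
next
  fix H assume "H \<in> (\<lambda>S. (S, nsets S 2)) ` cliques (edges G) (verts G) s"
  then obtain S where S: "H = (S, nsets S 2)" "S \<subseteq> verts G" "finite S" "card S = s" "nsets S 2 \<subseteq> edges G"
    by (auto simp: in_cliques_iff)
  then obtain f where f: "bij_betw f {..<s} S"
    using ex_bij_betw_nat_finite[of S] by (auto simp: atLeast0LessThan)
  then have "isomorphic (complete_graph s) H"
    using bij_betw_nsets[OF f, of 2] S(1)
    by (auto simp: isomorphic_def complete_graph_def bij_betw_def)
  then show "H \<in> copies (complete_graph s) G"
    using S by (auto simp: copies_def subgraph_def finite_simple_graph_def)
qed

lemma card_copies_complete_graph:
  assumes G: "finite_simple_graph G"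
  shows "card (copies (complete_graph s) G) = card (cliques (edges G) (verts G) s)"
  unfolding copies_complete_graph[OF G] by (rule card_image) (auto simp: inj_on_def)

lemma cliques_2:
  assumes "E \<subseteq> nsets V 2"
  shows "cliques E V 2 = E"
proof -
  have "nsets S 2 = {S}" if "S \<in> nsets V 2" for S
    using that by (auto elim!: nsets2_E)
  then show ?thesis using assms by (auto simp: cliques_def)
qed

lemma clique_weight_one: "clique_weight E V (\<lambda>_. 1) k = real (card (cliques E V k))"
  by (simp add: clique_weight_def)

text \<open>With all weights 1, \<open>clique_weight_bound\<close> leaves an error governed by the
  number of cliques of order \<open>r + 1\<close>, which \<open>few_cliques\<close> makes
  negligible.\<close>

lemma clique_count_upper:
  fixes F :: "'a sgraph" and \<epsilon> :: real
  assumes F: "finite_simple_graph F" "proper_coloring F (Suc r) c" and "r \<ge> 2" "s \<ge> 3" "\<epsilon> > 0"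
  shows "\<exists>m0. \<forall>G::nat sgraph. finite_simple_graph G \<longrightarrow> free_of F G \<longrightarrow> m0 \<le> card (edges G) \<longrightarrow>
    real (card (copies (complete_graph s) G)) \<le> (turan_const r s + \<epsilon>) * sqrt (real (card (edges G))) ^ s"
proof -
  obtain k where k: "Suc r = k + 2" "k \<ge> 1" using \<open>r \<ge> 2\<close> by (intro that[of "r - 1"]) auto
  \<comment> \<open>\<open>\<epsilon>1\<close> and \<open>\<epsilon>2\<close> are chosen so that
    each of the two error terms contributes at most \<open>\<epsilon> / 2 * M ^ s\<close>.\<close>
  define \<epsilon>1 where "\<epsilon>1 = \<epsilon> / (2 * 2 ^ s)"
  define \<epsilon>2 where "\<epsilon>2 = \<epsilon> / 2 * \<epsilon>1 ^ Suc r / (2 ^ s * fact (Suc r))"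
  have pos: "\<epsilon>1 > 0" "\<epsilon>2 > 0" using \<open>\<epsilon> > 0\<close> by (simp_all add: \<epsilon>1_def \<epsilon>2_def)
  obtain m0 where m0: "\<forall>(V::nat set) E. finite V \<longrightarrow> E \<subseteq> nsets V 2 \<longrightarrow> m0 \<le> card E \<longrightarrow>
    \<not> (\<exists>f. inj_on f (verts F) \<and> f ` verts F \<subseteq> V \<and> (\<forall>e\<in>edges F. f ` e \<in> E)) \<longrightarrow>
    real (card (cliques E V (Suc r))) \<le> \<epsilon>2 * sqrt (real (card E)) ^ Suc r"
    using few_cliques[OF F(1) F(2)[unfolded k] \<open>\<epsilon>2 > 0\<close> k(2)] unfolding k by (elim exE)
  have "real (card (copies (complete_graph s) G)) \<le> (turan_const r s + \<epsilon>) * sqrt (real (card (edges G))) ^ s"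
    if G: "finite_simple_graph G" "free_of F G" "max 1 m0 \<le> card (edges G)" for G :: "nat sgraph"
  proof -
    define V E where "V = verts G" "E = edges G"
    have VE: "finite V" "E \<subseteq> nsets V 2" using G(1) by (auto simp: V_E_def finite_simple_graph_def)
    define M where "M = sqrt (real (card E))"
    have "M > 0" using G(3) by (simp add: M_def V_E_def)
    have M2: "clique_weight E V (\<lambda>_. 1) 2 = M^2"
      unfolding clique_weight_one cliques_2[OF VE(2)] by (simp add: M_def)
    have "\<not> (\<exists>f. inj_on f (verts F) \<and> f ` verts F \<subseteq> V \<and> (\<forall>e\<in>edges F. f ` e \<in> E))"
      using not_free_ofI[OF F(1), of _ G] G(2) unfolding V_E_def by metis
    moreover have "m0 \<le> card E" using G(3) by (simp add: V_E_def)
    ultimately have few: "real (card (cliques E V (Suc r))) \<le> \<epsilon>2 * M ^ Suc r"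
      using m0 VE unfolding M_def by simp
    have "real (card (cliques E V s)) \<le> (turan_const r s + 2 ^ s * \<epsilon>1) * M ^ s
      + 2 ^ s * M ^ s * fact (Suc r) / (\<epsilon>1 * M) ^ Suc r * real (card (cliques E V (Suc r)))"
      using clique_weight_bound[OF VE(1) _ M2 \<open>M > 0\<close> pos(1) assms(3,4)]
      unfolding clique_weight_one by simp
    also have "\<dots> \<le> (turan_const r s + 2 ^ s * \<epsilon>1) * M ^ s
      + 2 ^ s * M ^ s * fact (Suc r) / (\<epsilon>1 * M) ^ Suc r * (\<epsilon>2 * M ^ Suc r)"
      by (intro add_left_mono mult_left_mono few) (use pos \<open>M > 0\<close> in auto)
    also have "2 ^ s * M ^ s * fact (Suc r) / (\<epsilon>1 * M) ^ Suc r * (\<epsilon>2 * M ^ Suc r) = \<epsilon> / 2 * M ^ s"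
    proof -
      have "2 ^ s * M ^ s * fact (Suc r) / (\<epsilon>1 * M) ^ Suc r * (\<epsilon>2 * M ^ Suc r)
        = 2 ^ s * M ^ s * fact (Suc r) / \<epsilon>1 ^ Suc r * \<epsilon>2"
        using \<open>M > 0\<close> by (simp add: power_mult_distrib del: power_Suc fact_Suc)
      also have "\<dots> = \<epsilon> / 2 * M ^ s"
        unfolding \<epsilon>2_def using pos(1) by (simp del: power_Suc fact_Suc)
      finally show ?thesis .
    qed
    also have "2 ^ s * \<epsilon>1 = \<epsilon> / 2" by (simp add: \<epsilon>1_def)
    finally show ?thesis
      unfolding card_copies_complete_graph[OF G(1)] M_def V_E_def by (simp add: algebra_simps)
  qed
  then show ?thesis by (intro exI[of _ "max 1 m0"]) blast
qed

section \<open>The multipartite construction\<close>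

text \<open>A colouring of the host pulls back along a copy of \<open>F\<close>.\<close>

lemma free_of_colorable:
  assumes "proper_coloring G r c" "\<not> (\<exists>c. proper_coloring F r c)"
  shows "free_of F G"
  unfolding free_of_def
proof (rule notI, elim exE conjE)
  fix H assume H: "subgraph H G" "isomorphic F H"
  then obtain f where f: "bij_betw f (verts F) (verts H)" "(\<lambda>e. f ` e) ` edges F = edges H"
    by (auto simp: isomorphic_def)
  have "proper_coloring F r (c \<circ> f)"
    unfolding proper_coloring_def
  proof (intro conjI ballI allI impI)
    fix v assume "v \<in> verts F"
    then have "f v \<in> verts G" using f(1) H(1) by (auto simp: bij_betw_def subgraph_def)
    then show "(c \<circ> f) v < r" using assms(1) by (simp add: proper_coloring_def)
  next
    fix u v assume "{u, v} \<in> edges F"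
    then have "f ` {u, v} \<in> edges H" using f(2) by blast
    then have "{f u, f v} \<in> edges G" using H(1) by (auto simp: subgraph_def)
    then show "(c \<circ> f) u \<noteq> (c \<circ> f) v" using assms(1) by (simp add: proper_coloring_def)
  qed
  then show False using assms(2) by blast
qed

text \<open>The \<open>k\<close>-cliques of the complete \<open>r\<close>-partite graph whose parts are the residue classes modulo \<open>r\<close>
  in \<open>{..<r * a}\<close>.\<close>

definition rainbow_sets :: "nat \<Rightarrow> nat \<Rightarrow> nat \<Rightarrow> nat set set" where
  "rainbow_sets r a k = {S \<in> nsets {..<r * a} k. inj_on (\<lambda>v. v mod r) S}"

text \<open>A set is encoded by its set \<open>I\<close> of residues and, for each
  \<open>i \<in> I\<close>, a quotient \<open>g i < a\<close>; the corresponding element is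
  \<open>i + r * g i\<close>.\<close>

lemma card_rainbow_sets:
  assumes "r > 0"
  shows "card (rainbow_sets r a k) = (r choose k) * a ^ k"
proof -
  define X where "X = Sigma (nsets {..<r} k) (\<lambda>I. PiE I (\<lambda>_. {..<a}))"
  define h where "h = (\<lambda>(I, g). (\<lambda>i. i + r * g i) ` I :: nat set)"
  \<comment> \<open>Restricting to the residues of \<open>S\<close> makes the quotient map
    extensional, as membership in \<open>PiE\<close> demands.\<close>
  define h' where "h' S = ((\<lambda>v. v mod r) ` S,
    \<lambda>i\<in>(\<lambda>v. v mod r) ` S. inv_into S (\<lambda>v. v mod r) i div r)" for S
  have "bij_betw h X (rainbow_sets r a k)"
  proof (rule bij_betw_byWitness[where f' = h'])
    have md: "(i + r * j) mod r = i" "(i + r * j) div r = j" if "i < r" for i j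
      using that assms by auto
    have inj: "inj_on (\<lambda>v. v mod r) (h (I, g))" and inj': "inj_on (\<lambda>i. i + r * g i) I"
      and im: "(\<lambda>v. v mod r) ` h (I, g) = I" if "(I, g) \<in> X" for I g
    proof -
      have I: "i < r" if "i \<in> I" for i using that \<open>(I, g) \<in> X\<close> by (auto simp: X_def nsets_def)
      then have mdI: "(i + r * g i) mod r = i" if "i \<in> I" for i using md that by blast
      show "inj_on (\<lambda>v. v mod r) (h (I, g))"
        unfolding h_def prod.case
        by (rule inj_on_imageI, rule inj_onI) (simp only: comp_apply mdI)
      show "inj_on (\<lambda>i. i + r * g i) I"
        by (rule inj_on_inverseI[where g = "\<lambda>v. v mod r"]) (rule mdI)
      have "(\<lambda>i. (i + r * g i) mod r) ` I = (\<lambda>i. i) ` I"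
        by (rule image_cong) (simp_all only: mdI)
      then show "(\<lambda>v. v mod r) ` h (I, g) = I"
        unfolding h_def prod.case image_image by simp
    qed
    have fst_h': "fst (h' S) = (\<lambda>v. v mod r) ` S" for S
      by (simp only: h'_def fst_conv)
    have snd_h': "snd (h' S) i = (if i \<in> (\<lambda>v. v mod r) ` S then inv_into S (\<lambda>v. v mod r) i div r
        else undefined)" for S i
      by (simp only: h'_def snd_conv restrict_def)
    have "h' (h (I, g)) = (I, g)" if Ig: "(I, g) \<in> X" for I g
    proof (rule prod_eqI)
      show "fst (h' (h (I, g))) = fst (I, g)" by (simp only: fst_h' im[OF Ig] fst_conv)
      show "snd (h' (h (I, g))) = snd (I, g)"
      proof (rule ext)
        fix i
        show "snd (h' (h (I, g))) i = snd (I, g) i"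
        proof (cases "i \<in> I")
          case True
          then have "i < r" using Ig by (auto simp: X_def nsets_def)
          have "i + r * g i \<in> h (I, g)" using True by (simp add: h_def)
          from inv_into_f_f[OF inj[OF Ig] this]
          have "inv_into (h (I, g)) (\<lambda>v. v mod r) i = i + r * g i"
            by (simp only: md(1)[OF \<open>i < r\<close>])
          then show ?thesis
            using True by (simp only: snd_h' im[OF Ig] md(2)[OF \<open>i < r\<close>] if_True snd_conv)
        next
          case False
          have "g \<in> PiE I (\<lambda>_. {..<a})" using Ig by (simp add: X_def)
          then have "g i = undefined" using False by (rule PiE_arb)
          then show ?thesis using False by (simp only: snd_h' im[OF Ig] if_False snd_conv)
        qed
      qed
    qed
    then show "\<forall>x\<in>X. h' (h x) = x" by (metis surj_pair)
    show "h ` X \<subseteq> rainbow_sets r a k"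
    proof clarify
      fix I g assume Ig: "(I, g) \<in> X"
      have I: "finite I" "card I = k" "\<And>i. i \<in> I \<Longrightarrow> i < r \<and> g i < a"
        using Ig by (auto simp: X_def nsets_def PiE_iff)
      have "i + r * g i < r * a" if "i \<in> I" for i
      proof -
        have "i + r * g i < r * Suc (g i)" using I(3)[OF that] by simp
        also have "\<dots> \<le> r * a" using I(3)[OF that] by (intro mult_le_mono2) simp
        finally show ?thesis .
      qed
      then have "h (I, g) \<subseteq> {..<r * a}" by (auto simp: h_def)
      moreover have "finite (h (I, g))" "card (h (I, g)) = k"
        using I card_image[OF inj'[OF Ig]] by (auto simp: h_def)
      ultimately show "h (I, g) \<in> rainbow_sets r a k"
        using inj[OF Ig] by (simp add: rainbow_sets_def nsets_def)
    qed
    have R: "S \<subseteq> {..<r * a}" "finite S" "card S = k" "inj_on (\<lambda>v. v mod r) S"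
      if "S \<in> rainbow_sets r a k" for S using that by (auto simp: rainbow_sets_def nsets_def)
    show "\<forall>S\<in>rainbow_sets r a k. h (h' S) = S"
    proof
      fix S assume S: "S \<in> rainbow_sets r a k"
      have "h (h' S) = (\<lambda>i. i + r * (inv_into S (\<lambda>v. v mod r) i div r)) ` (\<lambda>v. v mod r) ` S"
        unfolding h_def h'_def by (simp add: image_image)
      also have "\<dots> = (\<lambda>v. v mod r + r * (v div r)) ` S"
        unfolding image_image using inv_into_f_f[OF R(4)[OF S]] by (intro image_cong) auto
      finally show "h (h' S) = S" by simp
    qed
    show "h' ` rainbow_sets r a k \<subseteq> X"
    proof (rule image_subsetI)
      fix S assume S: "S \<in> rainbow_sets r a k"
      have "v div r < a" if "v \<in> S" for v
        using R(1)[OF S] that by (auto simp: less_mult_imp_div_less mult.commute)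
      then have "snd (h' S) \<in> PiE ((\<lambda>v. v mod r) ` S) (\<lambda>_. {..<a})"
        using inv_into_into[of _ "\<lambda>v. v mod r" S] by (auto simp: h'_def)
      moreover have "(\<lambda>v. v mod r) ` S \<in> nsets {..<r} k"
        using R[OF S] assms by (auto simp: nsets_def card_image)
      ultimately show "h' S \<in> X"
        unfolding X_def h'_def by simp
    qed
  qed
  then have "card (rainbow_sets r a k) = card X" by (rule bij_betw_same_card[symmetric])
  also have "\<dots> = (\<Sum>I\<in>nsets {..<r} k. card (PiE I (\<lambda>_. {..<a})))"
    unfolding X_def by (rule card_SigmaI) (auto simp: finite_imp_finite_nsets nsets_def intro!: finite_PiE)
  also have "\<dots> = (\<Sum>I\<in>nsets {..<r} k. a ^ k)"
    by (rule sum.cong[OF refl]) (auto simp: nsets_def card_PiE)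
  finally show ?thesis by (simp add: card_nsets)
qed

text \<open>The missing edges are supplied by disjoint edges on new vertices: the graph stays
  \<open>r\<close>-colourable because \<open>r \<ge> 2\<close>, and no clique is lost.\<close>

lemma turan_plus_matching:
  assumes "r \<ge> 2" "(r choose 2) * a ^ 2 \<le> m"
  obtains G :: "nat sgraph" and c where "finite_simple_graph G" "card (edges G) = m"
    "proper_coloring G r c" "(r choose s) * a ^ s \<le> card (copies (complete_graph s) G)"
proof -
  define B E0 where "B = r * a" "E0 = rainbow_sets r a 2"
  define d where "d = m - card E0"
  define E1 where "E1 = (\<lambda>i. {B + 2 * i, Suc (B + 2 * i)}) ` {..<d}"
  define V where "V = {..<B + 2 * d}"
  define G where "G = (V, E0 \<union> E1)"
  \<comment> \<open>Below \<open>B\<close> the residues are the parts; beyond \<open>B\<close>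
    parity separates the two ends of each matching edge.\<close>
  define c where "c v = (if v < B then v mod r else (v - B) mod 2)" for v
  have cardE0: "card E0 \<le> m"
    using card_rainbow_sets[of r a 2] assms by (simp add: B_E0_def)
  have E0V: "E0 \<subseteq> nsets V 2" by (auto simp: B_E0_def rainbow_sets_def nsets_def V_def)
  have E1V: "E1 \<subseteq> nsets V 2" by (auto simp: E1_def V_def)
  have fin: "finite V" by (simp add: V_def)
  have G: "finite_simple_graph G"
    using E0V E1V fin by (simp add: finite_simple_graph_def G_def)
  have "finite E0" "finite E1"
    using E0V E1V fin finite_imp_finite_nsets finite_subset by blast+
  moreover have "E0 \<inter> E1 = {}"
  proof -
    have "e \<subseteq> {..<B}" if "e \<in> E0" for e using that by (auto simp: B_E0_def rainbow_sets_def nsets_def)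
    moreover have "\<not> e \<subseteq> {..<B}" if "e \<in> E1" for e using that by (auto simp: E1_def)
    ultimately show ?thesis by blast
  qed
  moreover have "card E1 = d"
    unfolding E1_def by (subst card_image) (auto simp: inj_on_def doubleton_eq_iff)
  ultimately have cardE: "card (edges G) = m"
    using cardE0 by (simp add: G_def card_Un_disjoint d_def)
  have col: "proper_coloring G r c"
    unfolding proper_coloring_def
  proof (intro conjI ballI allI impI)
    fix v assume "v \<in> verts G"
    have "(v - B) mod 2 < 2" by simp
    then have "(v - B) mod 2 < r" using assms(1) by linarith
    then show "c v < r" using assms(1) by (simp add: c_def)
  next
    fix u v assume "{u, v} \<in> edges G"
    then consider "{u, v} \<in> E0" | "{u, v} \<in> E1" by (auto simp: G_def)
    then show "c u \<noteq> c v"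
    proof cases
      case 1
      then have uv: "{u, v} \<in> nsets {..<B} 2" "inj_on (\<lambda>v. v mod r) {u, v}"
        unfolding B_E0_def rainbow_sets_def by blast+
      have "u \<noteq> v" using uv(1) by simp
      then have "u mod r \<noteq> v mod r" using inj_onD[OF uv(2), of u v] by blast
      then show ?thesis using uv by (simp add: c_def)
    next
      case 2
      then obtain i where "{u, v} = {B + 2 * i, Suc (B + 2 * i)}" by (auto simp: E1_def)
      moreover have "c (B + 2 * i) = 0" "c (Suc (B + 2 * i)) = 1" by (simp_all add: c_def)
      ultimately show ?thesis by (auto simp: doubleton_eq_iff)
    qed
  qed
  have "rainbow_sets r a s \<subseteq> cliques (edges G) (verts G) s"
  proof
    fix S assume S: "S \<in> rainbow_sets r a s"
    then have "S \<subseteq> {..<B}" "finite S" "card S = s" "inj_on (\<lambda>v. v mod r) S"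
      by (simp_all add: rainbow_sets_def nsets_def B_E0_def)
    moreover from this have "nsets S 2 \<subseteq> E0"
      unfolding B_E0_def rainbow_sets_def using nsets_mono[of S "{..<r * a}" 2]
      by (auto simp: nsets_def intro: inj_on_subset)
    ultimately show "S \<in> cliques (edges G) (verts G) s"
      by (auto simp: in_cliques_iff G_def V_def)
  qed
  then have "card (rainbow_sets r a s) \<le> card (cliques (edges G) (verts G) s)"
    by (rule card_mono[rotated]) (use fin in \<open>simp add: G_def\<close>)
  then have "(r choose s) * a ^ s \<le> card (copies (complete_graph s) G)"
    using card_rainbow_sets[of r a s] assms by (simp add: card_copies_complete_graph[OF G])
  then show ?thesis using G cardE col by (intro that)
qed

text \<open>A clique with at least two vertices is the union of its edges, so distinct cliques have
  distinct edge sets. The bound does not involve the number of vertices and thus makes the set under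
  \<open>Max\<close> in \<open>mex\<close> finite.\<close>

lemma card_copies_complete_graph_le:
  assumes G: "finite_simple_graph G" and "s \<ge> 2"
  shows "card (copies (complete_graph s) G) \<le> 2 ^ card (edges G)"
proof -
  have fin: "finite (edges G)"
    using G finite_imp_finite_nsets finite_subset unfolding finite_simple_graph_def by blast
  have un: "\<Union> (nsets S 2) = S" if "S \<in> cliques (edges G) (verts G) s" for S
  proof
    show "\<Union> (nsets S 2) \<subseteq> S" by (auto simp: nsets_def)
    show "S \<subseteq> \<Union> (nsets S 2)"
    proof
      fix v assume v: "v \<in> S"
      have "\<not> S \<subseteq> {v}"
      proof
        assume "S \<subseteq> {v}"
        then have "card S \<le> card {v}" by (intro card_mono) auto
        then show False using that assms(2) by (simp add: in_cliques_iff)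
      qed
      then obtain w where "w \<in> S" "w \<noteq> v" by blast
      then have "{v, w} \<in> nsets S 2" using v by simp
      then show "v \<in> \<Union> (nsets S 2)" by blast
    qed
  qed
  have "inj_on (\<lambda>S. nsets S 2) (cliques (edges G) (verts G) s)"
    by (rule inj_on_inverseI[where g = Union]) (rule un)
  moreover have "(\<lambda>S. nsets S 2) ` cliques (edges G) (verts G) s \<subseteq> Pow (edges G)"
    by (auto simp: in_cliques_iff)
  ultimately have "card (cliques (edges G) (verts G) s) \<le> card (Pow (edges G))"
    by (rule card_inj_on_le) (use fin in simp)
  then show ?thesis using fin by (simp add: card_copies_complete_graph[OF G] card_Pow)
qed

text \<open>\<open>Max\<close> is meaningful only on finite nonempty sets. Finiteness comes from the
  bound on copies by the number of edges; the given \<open>F\<close>-free graph shows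
  nonemptiness.\<close>

lemma
  fixes F :: "'a sgraph"
  assumes "s \<ge> 2"
  shows mex_ge: "\<And>G :: nat sgraph. finite_simple_graph G \<Longrightarrow> free_of F G \<Longrightarrow>
      card (copies (complete_graph s) G) \<le> mex (complete_graph s) (card (edges G)) F"
    and mex_attained: "\<And>G0 :: nat sgraph. finite_simple_graph G0 \<Longrightarrow> free_of F G0 \<Longrightarrow>
      \<exists>G :: nat sgraph. finite_simple_graph G \<and> card (edges G) = card (edges G0) \<and> free_of F G
        \<and> mex (complete_graph s) (card (edges G0)) F = card (copies (complete_graph s) G)"
proof -
  define X where "X m = {card (copies (complete_graph s) G) | G :: nat sgraph.
    finite_simple_graph G \<and> card (edges G) = m \<and> free_of F G}" for m
  have fin: "finite (X m)" for m
    by (rule finite_subset[of _ "{..2 ^ m}"])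
       (use card_copies_complete_graph_le assms in \<open>auto simp: X_def\<close>)
  have mex: "mex (complete_graph s) m F = Max (X m)" for m
    by (simp add: mex_def X_def)
  fix G :: "nat sgraph" assume G: "finite_simple_graph G" "free_of F G"
  then have mem: "card (copies (complete_graph s) G) \<in> X (card (edges G))"
    unfolding X_def by blast
  show "card (copies (complete_graph s) G) \<le> mex (complete_graph s) (card (edges G)) F"
    unfolding mex by (rule Max_ge[OF fin mem])
  have "Max (X (card (edges G))) \<in> X (card (edges G))"
    by (rule Max_in[OF fin]) (use mem in blast)
  then show "\<exists>G' :: nat sgraph. finite_simple_graph G' \<and> card (edges G') = card (edges G) \<and> free_of F G'
        \<and> mex (complete_graph s) (card (edges G)) F = card (copies (complete_graph s) G')"
    unfolding mex X_def by blast
qed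

section \<open>Asymptotics\<close>

text \<open>The limit depends on \<open>F\<close> only through its colourability, so the lemma
  serves both for the given graph and for the complete graph on \<open>r + 1\<close>
  vertices.\<close>

lemma mex_tendsto:
  fixes F :: "'a sgraph"
  assumes F: "finite_simple_graph F" "proper_coloring F (Suc r) c" "\<not> (\<exists>c. proper_coloring F r c)"
    and "r \<ge> 2" "s \<ge> 3"
  shows "(\<lambda>m. real (mex (complete_graph s) m F) / sqrt (real m) ^ s) \<longlonglongrightarrow> turan_const r s"
proof -
  have "s \<ge> 2" using assms by simp
  define b where "b = real (r choose 2)"
  have "b > 0" using assms by (simp add: b_def)
  \<comment> \<open>The largest part size for which the balanced \<open>r\<close>-partite graph has
    at most \<open>m\<close> edges; rounding down costs at most 1.\<close>
  define a where "a m = nat \<lfloor>sqrt (real m / b)\<rfloor>" for m :: nat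
  have a_le: "real (a m) \<le> sqrt (real m / b)" for m
    using \<open>b > 0\<close> by (simp add: a_def)
  have a_ge: "sqrt (real m / b) - 1 \<le> real (a m)" for m
    unfolding a_def by linarith
  have ab: "(r choose 2) * a m ^ 2 \<le> m" for m
  proof -
    have "real (a m) ^ 2 \<le> sqrt (real m / b) ^ 2" by (rule power_mono[OF a_le]) simp
    then have "b * real (a m) ^ 2 \<le> real m" using \<open>b > 0\<close> by (simp add: field_simps)
    then have "real ((r choose 2) * a m ^ 2) \<le> real m" by (simp add: b_def)
    then show ?thesis by (simp only: of_nat_le_iff)
  qed
  \<comment> \<open>One construction serves twice: as a lower bound, and as a witness that some
    \<open>F\<close>-free graph has \<open>m\<close> edges, so that the maximum is attained.\<close>
  have lower: "real (r choose s) * real (a m) ^ s \<le> real (mex (complete_graph s) m F)"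
    and attained: "\<exists>G :: nat sgraph. finite_simple_graph G \<and> card (edges G) = m \<and> free_of F G
        \<and> mex (complete_graph s) m F = card (copies (complete_graph s) G)" for m
  proof -
    obtain G :: "nat sgraph" and c' where G: "finite_simple_graph G" "card (edges G) = m"
      "proper_coloring G r c'" "(r choose s) * a m ^ s \<le> card (copies (complete_graph s) G)"
      by (rule turan_plus_matching[OF \<open>r \<ge> 2\<close> ab])
    have free: "free_of F G" by (rule free_of_colorable[OF G(3) F(3)])
    have "(r choose s) * a m ^ s \<le> mex (complete_graph s) m F"
      using G(4) mex_ge[OF \<open>s \<ge> 2\<close> G(1) free] G(2) by simp
    then have "real ((r choose s) * a m ^ s) \<le> real (mex (complete_graph s) m F)"
      by (simp only: of_nat_le_iff)
    then show "real (r choose s) * real (a m) ^ s \<le> real (mex (complete_graph s) m F)" by simp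
    show "\<exists>G :: nat sgraph. finite_simple_graph G \<and> card (edges G) = m \<and> free_of F G
        \<and> mex (complete_graph s) m F = card (copies (complete_graph s) G)"
      using mex_attained[OF \<open>s \<ge> 2\<close> G(1) free] G(2) by simp
  qed
  have sqrt_lim: "filterlim (\<lambda>m. sqrt (real m)) at_top sequentially"
    by (rule filterlim_compose[OF sqrt_at_top filterlim_real_sequentially])
  have "(\<lambda>m. real (a m) / sqrt (real m)) \<longlonglongrightarrow> 1 / sqrt b"
  proof (rule tendsto_sandwich)
    show "\<forall>\<^sub>F m in sequentially. 1 / sqrt b - 1 / sqrt (real m) \<le> real (a m) / sqrt (real m)"
      using eventually_gt_at_top[of 0]
    proof eventually_elim
      case (elim m)
      have "1 / sqrt b - 1 / sqrt (real m) = (sqrt (real m / b) - 1) / sqrt (real m)"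
        using elim \<open>b > 0\<close> by (simp add: real_sqrt_divide field_simps)
      also have "\<dots> \<le> real (a m) / sqrt (real m)"
        by (rule divide_right_mono[OF a_ge]) simp
      finally show ?case .
    qed
    show "\<forall>\<^sub>F m in sequentially. real (a m) / sqrt (real m) \<le> 1 / sqrt b"
      using eventually_gt_at_top[of 0]
    proof eventually_elim
      case (elim m)
      have "real (a m) / sqrt (real m) \<le> sqrt (real m / b) / sqrt (real m)"
        by (rule divide_right_mono[OF a_le]) simp
      also have "\<dots> = 1 / sqrt b" using elim by (simp add: real_sqrt_divide)
      finally show ?case .
    qed
    have "(\<lambda>m. 1 / sqrt b - 1 / sqrt (real m)) \<longlonglongrightarrow> 1 / sqrt b - 0"
      by (intro tendsto_diff tendsto_const real_tendsto_divide_at_top[OF tendsto_const] sqrt_lim)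
    then show "(\<lambda>m. 1 / sqrt b - 1 / sqrt (real m)) \<longlonglongrightarrow> 1 / sqrt b" by simp
  qed simp
  then have "(\<lambda>m. real (r choose s) * (real (a m) / sqrt (real m)) ^ s)
      \<longlonglongrightarrow> real (r choose s) * (1 / sqrt b) ^ s"
    by (intro tendsto_mult_left tendsto_power)
  then have low_lim: "(\<lambda>m. real (r choose s) * (real (a m) / sqrt (real m)) ^ s) \<longlonglongrightarrow> turan_const r s"
    by (simp add: turan_const_def b_def power_divide)
  show ?thesis
  \<comment> \<open>The lower bound converges to the limit by itself, while the upper bound is
    available only for each \<open>\<epsilon>\<close> separately.\<close>
  proof (rule order_tendstoI)
    fix y assume "y < turan_const r s"
    from order_tendstoD(1)[OF low_lim this]
    show "\<forall>\<^sub>F m in sequentially. y < real (mex (complete_graph s) m F) / sqrt (real m) ^ s"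
    proof eventually_elim
      case (elim m)
      also have "real (r choose s) * (real (a m) / sqrt (real m)) ^ s
          = (real (r choose s) * real (a m) ^ s) / sqrt (real m) ^ s"
        by (simp add: power_divide)
      also have "\<dots> \<le> real (mex (complete_graph s) m F) / sqrt (real m) ^ s"
        by (rule divide_right_mono[OF lower]) simp
      finally show ?case .
    qed
  next
    fix y assume y: "turan_const r s < y"
    define \<epsilon> where "\<epsilon> = (y - turan_const r s) / 2"
    have "\<epsilon> > 0" "turan_const r s + \<epsilon> < y" using y by (auto simp: \<epsilon>_def field_simps)
    obtain m0 where m0: "\<forall>G::nat sgraph. finite_simple_graph G \<longrightarrow> free_of F G \<longrightarrow> m0 \<le> card (edges G) \<longrightarrow>
      real (card (copies (complete_graph s) G)) \<le> (turan_const r s + \<epsilon>) * sqrt (real (card (edges G))) ^ s"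
      using clique_count_upper[OF F(1,2) assms(4,5) \<open>\<epsilon> > 0\<close>] by (elim exE)
    show "\<forall>\<^sub>F m in sequentially. real (mex (complete_graph s) m F) / sqrt (real m) ^ s < y"
      using eventually_ge_at_top[of m0] eventually_gt_at_top[of 0]
    proof eventually_elim
      case (elim m)
      obtain G :: "nat sgraph" where G: "finite_simple_graph G" "card (edges G) = m" "free_of F G"
        "mex (complete_graph s) m F = card (copies (complete_graph s) G)"
        using attained[of m] by (elim exE conjE)
      have "real (mex (complete_graph s) m F) \<le> (turan_const r s + \<epsilon>) * sqrt (real m) ^ s"
        using m0[rule_format, OF G(1,3)] G(2,4) elim(1) by simp
      then have "real (mex (complete_graph s) m F) / sqrt (real m) ^ s \<le> turan_const r s + \<epsilon>"
        using elim(2) by (simp add: pos_divide_le_eq)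
      then show ?case using \<open>turan_const r s + \<epsilon> < y\<close> by linarith
    qed
  qed
qed

text \<open>An injective colouring works. Existence ensures that the \<open>LEAST\<close> in
  \<open>chromatic_number\<close> is attained.\<close>

lemma finite_graph_colorable:
  assumes "finite_simple_graph F"
  shows "\<exists>k c. proper_coloring F k c"
proof -
  obtain h where h: "bij_betw h (verts F) {0..<card (verts F)}"
    using ex_bij_betw_finite_nat assms by (auto simp: finite_simple_graph_def)
  have "proper_coloring F (card (verts F)) h"
    unfolding proper_coloring_def
  proof (intro conjI ballI allI impI)
    fix v assume "v \<in> verts F"
    then show "h v < card (verts F)" using h by (auto simp: bij_betw_def)
  next
    fix u v assume "{u, v} \<in> edges F"
    then have "{u, v} \<in> nsets (verts F) 2" using assms unfolding finite_simple_graph_def by blast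
    then show "h u \<noteq> h v" using h by (auto simp: bij_betw_def inj_on_def)
  qed
  then show ?thesis by blast
qed

lemma complete_graph_coloring:
  "proper_coloring (complete_graph (Suc r)) (Suc r) id"
  by (auto simp: proper_coloring_def complete_graph_def)

lemma complete_graph_not_colorable:
  "\<not> (\<exists>c. proper_coloring (complete_graph (Suc r)) r c)"
proof
  assume "\<exists>c. proper_coloring (complete_graph (Suc r)) r c"
  then obtain c where c: "proper_coloring (complete_graph (Suc r)) r c" ..
  have "inj_on c {..<Suc r}"
    using c by (auto simp: proper_coloring_def complete_graph_def inj_on_def)
  moreover have "c ` {..<Suc r} \<subseteq> {..<r}"
    using c by (auto simp: proper_coloring_def complete_graph_def)
  ultimately have "card {..<Suc r} \<le> card {..<r}" by (rule card_inj_on_le) simp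
  then show False by simp
qed

theorem theorem1p10:
  fixes r s :: nat and F :: "'a sgraph"
  assumes "r \<ge> 3" and "s \<ge> 3"
    and "finite_simple_graph F" and "chromatic_number F = r + 1"
  shows "(\<lambda>m. real (mex (complete_graph s) m F) - real (mex (complete_graph s) m (complete_graph (r + 1))))
           \<in> o[sequentially](\<lambda>m. real m powr (real s / 2))"
proof -
  have "\<exists>c. proper_coloring F (chromatic_number F) c"
    unfolding chromatic_number_def by (rule LeastI_ex) (rule finite_graph_colorable[OF assms(3)])
  then obtain c where c: "proper_coloring F (Suc r) c" using assms(4) by auto
  have nc: "\<not> (\<exists>c. proper_coloring F r c)"
    by (rule not_less_Least[where P = "\<lambda>k. \<exists>c. proper_coloring F k c"])
       (use assms(4) in \<open>simp add: chromatic_number_def\<close>)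
  have "finite_simple_graph (complete_graph (Suc r))"
    by (simp add: finite_simple_graph_def complete_graph_def)
  \<comment> \<open>The common limit cancels; the extremal graphs for the two maxima are never
    compared directly.\<close>
  have "(\<lambda>m. real (mex (complete_graph s) m F) / sqrt (real m) ^ s
        - real (mex (complete_graph s) m (complete_graph (Suc r))) / sqrt (real m) ^ s)
      \<longlonglongrightarrow> turan_const r s - turan_const r s"
    by (intro tendsto_diff mex_tendsto[OF assms(3) c nc]
        mex_tendsto[OF \<open>finite_simple_graph (complete_graph (Suc r))\<close> complete_graph_coloring
          complete_graph_not_colorable]) (use assms in simp_all)
  then have lim: "(\<lambda>m. (real (mex (complete_graph s) m F)
        - real (mex (complete_graph s) m (complete_graph (r + 1)))) / sqrt (real m) ^ s) \<longlonglongrightarrow> 0"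
    by (simp add: diff_divide_distrib)
  have powr: "real m powr (real s / 2) = sqrt (real m) ^ s" if "m > 0" for m
    using that by (simp add: powr_half_sqrt[symmetric] powr_realpow[symmetric] powr_powr)
  show ?thesis
  proof (rule smalloI_tendsto)
    show "(\<lambda>m. (real (mex (complete_graph s) m F)
        - real (mex (complete_graph s) m (complete_graph (r + 1)))) / (real m powr (real s / 2))) \<longlonglongrightarrow> 0"
      by (rule Lim_transform_eventually[OF lim])
         (use eventually_gt_at_top[of 0] in \<open>eventually_elim; simp add: powr\<close>)
    show "\<forall>\<^sub>F m in sequentially. real m powr (real s / 2) \<noteq> 0"
      using eventually_gt_at_top[of 0] by eventually_elim simp
  qed
qed

end
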